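(* Let $\Omega \subset \mathbb{R}^d$ be Lebesgue-measurable, $2 < p < q$, $f \in \mathrm{L}^2 (\Omega ; \mathbb{C}^m) \cap \mathrm{L}^p (\Omega ; \mathbb{C}^m)$, and let $T$ be an operator (not necessarily linear) such that $T(f)$ is defined and contained in $\mathrm{L}^2 (\Omega ; \mathbb{C}^n)$. Suppose that there exist constants $\alpha_2 > \alpha_1 > 1$ and $\mathcal{C} > 0$ such that for all $\iota > 0$, all $Q = Q(x_0 , r)$ with $r > 0$ and $x_0 \in \mathbb{R}^d$, and all parents $Q^*$ of $Q$ with $(2 Q^* ) \cap \Omega \neq \emptyset$ the estimate $$\lvert \{ x \in Q : M_{2 Q^*} (\lvert E_0 T (f) \rvert^2) (x) > \iota \} \rvert \leq \frac{\mathcal{C}}{\iota} \int_{(2 \alpha_2 Q^* ) \cap \Omega} \lvert f \rvert^2 \, dx + \frac{\mathcal{C} \lvert Q \rvert}{\iota^{q / 2}} \bigg\{ \bigg( \frac{1}{\lvert Q \rvert} \int_{(2 \alpha_2 Q^* ) \cap \Omega} \lvert T (f) \rvert^2 \, dx \bigg)^{\frac{1}{2}} + \sup_{Q^{\prime} \supset 2 Q^*} \bigg( \frac{1}{\lvert Q^{\prime} \rvert} \int_{Q^{\prime} \cap \Omega} \lvert f \rvert^2 \, dx \bigg)^{\frac{1}{2}} \bigg\}^q$$ holds. Here the supremum runs over all cubes $Q^{\prime}$ containing $2 Q^*$. Then there exists a constant $C > 0$ depending on $d$, $p$, $q$, $\alpha_1$, $\alpha_2$, and $\mathcal{C}$ such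 that $$\| T(f) \|_{\mathrm{L}^p (\Omega ; \mathbb{C}^n)} \leq C \| f \|_{\mathrm{L}^p (\Omega ; \mathbb{C}^m)}.$$
   Context: Here $m,n,d$ are positive integers. $E_0$ denotes extension by zero of functions on $\Omega$ to $\mathbb{R}^d$. Cubes are non-degenerate open cubes in $\mathbb{R}^d$ with sides parallel to the coordinate axes; $Q(x_0,r)$ is the cube with center $x_0$ and diameter $\operatorname{diam}(Q(x_0,r)) = r$. For $\alpha>0$ and $Q = Q(x_0,r)$, $\alpha Q := Q(x_0,\alpha r)$. A cube $Q^*$ is a parent of a cube $Q$ if $Q$ arises from $Q^*$ by bisecting its sides (i.e. $Q$ is one of the $2^d$ subcubes obtained by bisecting each side of $Q^*$). $|\cdot|$ of a set denotes Lebesgue measure. The localized maximal operator is $$M_{2 Q^*} g (x) := \sup_{R \ni x,\ R \subset 2 Q^*}\frac{1}{\lvert R \rvert} \int_R \lvert g \rvert \, dy \qquad (x \in 2 Q^* ),$$ where the supremum is over cubes $R$ in $\mathbb{R}^d$. *)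

theory Defs
  imports "HOL-Analysis.Analysis"
begin

text \<open>
  A vector in \<open>\<complex>\<^sup>k\<close> is a function \<^typ>\<open>nat \<Rightarrow> complex\<close> of which only the entries with index
  below \<open>k\<close> matter.  The dimension is a term rather than a type so that a constant can be
  chosen before it, i.e. uniformly in it.
\<close>

definition cnorm :: "nat \<Rightarrow> (nat \<Rightarrow> complex) \<Rightarrow> real" where
  "cnorm k v = L2_set (\<lambda>i. cmod (v i)) {..<k}"

text \<open>
  A function on \<open>\<Omega>\<close> is a total function of which only the values on \<open>\<Omega>\<close> matter.  Membership
  in \<open>L\<^sup>p(\<Omega>; \<complex>\<^sup>k)\<close> is kept apart from the real-valued norm, because \<open>Lp_norm\<close> is meaningless
  (a Bochner integral defaulting to 0) for functions outside the space.
\<close>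

definition Lp_space :: "nat \<Rightarrow> real \<Rightarrow> (real ^ 'd) set \<Rightarrow> (real ^ 'd \<Rightarrow> nat \<Rightarrow> complex) set" where
  "Lp_space k p \<Omega> = {u. (\<forall>i<k. (\<lambda>x. u x i) \<in> borel_measurable (lebesgue_on \<Omega>)) \<and>
                        integrable (lebesgue_on \<Omega>) (\<lambda>x. cnorm k (u x) powr p)}"

definition Lp_norm :: "nat \<Rightarrow> real \<Rightarrow> (real ^ 'd) set \<Rightarrow> (real ^ 'd \<Rightarrow> nat \<Rightarrow> complex) \<Rightarrow> real" where
  "Lp_norm k p \<Omega> u = (\<integral>x. cnorm k (u x) powr p \<partial>lebesgue_on \<Omega>) powr (1 / p)"

definition ext_zero :: "(real ^ 'd) set \<Rightarrow> (real ^ 'd \<Rightarrow> nat \<Rightarrow> complex) \<Rightarrow> real ^ 'd \<Rightarrow> nat \<Rightarrow> complex" where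
  "ext_zero \<Omega> u x = (if x \<in> \<Omega> then u x else (\<lambda>_. 0))"

text \<open>
  \<open>cube x r\<close> is the open axis-parallel cube with centre \<open>x\<close> and diameter (not side length) \<open>r\<close>;
  its side length is \<open>r / sqrt d\<close>.  It is non-degenerate iff \<open>r > 0\<close>, and its dilation by
  \<open>\<alpha>\<close> is \<open>cube x (\<alpha> * r)\<close>.
\<close>

definition cube :: "real ^ 'd \<Rightarrow> real \<Rightarrow> (real ^ 'd) set" where
  "cube x r = {y. \<forall>i. \<bar>y $ i - x $ i\<bar> < r / (2 * sqrt (real CARD('d)))}"

definition cubes :: "(real ^ 'd) set set" where
  "cubes = {cube x r |x r. 0 < r}"

text \<open>
  The \<open>2\<^sup>d\<close> subcubes obtained by bisecting the sides of \<open>cube y R\<close>: in every coordinate their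
  centre is off \<open>y\<close> by a quarter of the side length.  So \<open>cube y R\<close> is a parent of each of them.
\<close>

definition subcubes :: "real ^ 'd \<Rightarrow> real \<Rightarrow> (real ^ 'd) set set" where
  "subcubes y R = {cube z (R / 2) |z. \<forall>i. \<bar>z $ i - y $ i\<bar> = R / (4 * sqrt (real CARD('d)))}"

definition local_maximal :: "(real ^ 'd) set \<Rightarrow> (real ^ 'd \<Rightarrow> real) \<Rightarrow> real ^ 'd \<Rightarrow> ennreal" where
  "local_maximal B g x =
     (SUP R \<in> {R \<in> cubes. x \<in> R \<and> R \<subseteq> B}.
        (\<integral>\<^sup>+y\<in>R. ennreal \<bar>g y\<bar> \<partial>lebesgue) / emeasure lebesgue R)"

text \<open>
  The weak-type hypothesis for given \<open>f\<close> and \<open>Tf\<close>, with \<open>Q = cube x0 r\<close> and parent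
  \<open>Q* = cube y R\<close>.  It is meant for \<open>f\<close> and \<open>Tf\<close> in \<open>L\<^sup>2\<close>: then the integrals exist and the real
  supremum is over a bounded set, as \<open>|Q'| \<ge> |2Q*|\<close>.
\<close>

definition weak_type_estimate ::
  "nat \<Rightarrow> nat \<Rightarrow> real \<Rightarrow> real \<Rightarrow> real \<Rightarrow> (real ^ 'd) set \<Rightarrow>
   (real ^ 'd \<Rightarrow> nat \<Rightarrow> complex) \<Rightarrow> (real ^ 'd \<Rightarrow> nat \<Rightarrow> complex) \<Rightarrow> bool" where
  "weak_type_estimate m n q \<alpha>\<^sub>2 K \<Omega> f Tf \<longleftrightarrow>
     (\<forall>\<iota> > 0. \<forall>x0. \<forall>r > 0. \<forall>y. \<forall>R > 0.
        cube x0 r \<in> subcubes y R \<longrightarrow> cube y (2 * R) \<inter> \<Omega> \<noteq> {} \<longrightarrow>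
        measure lebesgue {x \<in> cube x0 r.
            local_maximal (cube y (2 * R)) (\<lambda>z. (cnorm n (ext_zero \<Omega> Tf z))\<^sup>2) x > ennreal \<iota>}
        \<le> K / \<iota> * (LINT x:cube y (2 * \<alpha>\<^sub>2 * R) \<inter> \<Omega>|lebesgue. (cnorm m (f x))\<^sup>2)
          + K * measure lebesgue (cube x0 r) / \<iota> powr (q / 2) *
            (sqrt (1 / measure lebesgue (cube x0 r) *
                   (LINT x:cube y (2 * \<alpha>\<^sub>2 * R) \<inter> \<Omega>|lebesgue. (cnorm n (Tf x))\<^sup>2))
             + (SUP Q' \<in> {Q' \<in> cubes. cube y (2 * R) \<subseteq> Q'}.
                  sqrt (1 / measure lebesgue Q' *
                        (LINT x:Q' \<inter> \<Omega>|lebesgue. (cnorm m (f x))\<^sup>2)))) powr q)"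

end

theory Submission imports Defs begin

text \<open>
  The theorem is Shen's \<open>L\<^sup>p\<close> extrapolation argument.  Put \<open>F = |E\<^sub>0 f|\<^sup>2\<close>, \<open>G = |E\<^sub>0 T(f)|\<^sup>2\<close> and
  \<open>s = p/2 > 1\<close>, and let \<open>M\<close> be the maximal operator over all cubes of the space.  Bounding the
  \<open>L\<^sup>p\<close> norm of \<open>T(f)\<close> by that of \<open>f\<close> means bounding \<open>\<integral> G\<^sup>s\<close> by \<open>\<integral> F\<^sup>s\<close>.

  The heart is the good-\<open>\<lambda>\<close> inequality (\<open>good_lambda\<close>)
  \<open>|{M G > A\<lambda>}| \<le> \<delta> |{M G > \<lambda>}| + |{M F > \<gamma>\<lambda>}|\<close> with \<open>\<delta> = A\<^sup>-\<^sup>s/2\<close>.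
  Decompose the open set \<open>{M G > \<lambda>}\<close> into maximal dyadic cubes \<open>Q\<close>
  (\<open>whitney_comparison\<close>).  The closure of the parent \<open>Q*\<close> contains a point where \<open>M G \<le> \<lambda>\<close>.  A cube
  that meets \<open>Q\<close> but leaves \<open>2Q*\<close> reaches that point after dilation by \<open>5\<close>, hence has \<open>G\<close>-average
  at most \<open>5\<^sup>d\<lambda> \<le> A\<lambda>\<close>.  So in \<open>Q\<close> only cubes inside \<open>2Q*\<close> can make \<open>M G\<close> exceed \<open>A\<lambda>\<close>, and the
  hypothesis applies at height \<open>A\<lambda>\<close>.  If \<open>Q\<close> contains a point with \<open>M F \<le> \<gamma>\<lambda>\<close>, all averages on its
  right-hand side are controlled by \<open>\<lambda>\<close> and \<open>\<gamma>\<lambda>\<close>, and the set has measure at most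
  \<open>(c \<gamma>/A + c' A\<^sup>-\<^sup>q\<^sup>/\<^sup>2) |Q|\<close> (\<open>local_level_estimate\<close>).  As \<open>q/2 > s\<close>, a large \<open>A\<close> followed by a small
  \<open>\<gamma>\<close> makes this at most \<open>\<delta> |Q|\<close>.

  To pass to integrals (\<open>power_integral_le_of_good_lambda\<close>), multiply by \<open>(A\<lambda>)\<^sup>s\<close> and sum over
  the geometric scale \<open>\<lambda> = l A\<^sup>j\<close>, \<open>j < J\<close>.  The factor \<open>A\<^sup>s\<delta> = 1/2\<close> lets the \<open>M G\<close>-terms telescope,
  leaving the first one and the \<open>M F\<close>-terms.  The first is \<open>O(l\<^sup>s\<^sup>-\<^sup>1)\<close> by the weak \<open>(1,1)\<close> bound
  (\<open>maximal_weak_type\<close>) and vanishes as \<open>l \<rightarrow> 0\<close>, because \<open>G\<close> is integrable and \<open>s > 1\<close>.  The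
  others are bounded by \<open>\<integral> F\<^sup>s\<close> through the weak bound for the part of \<open>F\<close> above half the height
  (\<open>maximal_truncated_weak_type\<close>).  Finally \<open>|{G > \<lambda>}| \<le> |{M G > \<lambda>}|\<close>
  (\<open>emeasure_level_le_maximal\<close>) turns the sums over \<open>M G\<close> into a bound for \<open>\<integral> G\<^sup>s\<close>.
\<close>

section \<open>Cubes\<close>

(* The simp rule rewrites Lebesgue measure to Borel measure of the main part of a set,
   after which facts about the measure of cubes no longer match. *)
declare emeasure_completion [simp del]

lemma cube_eq_box: "cube (c :: real ^ 'd) r =
    box (c - (\<chi> i. r / (2 * sqrt (real CARD('d))))) (c + (\<chi> i. r / (2 * sqrt (real CARD('d)))))"
  by (auto simp: cube_def set_eq_iff mem_box_cart abs_less_iff algebra_simps)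

lemma open_cube: "open (cube c r)"
  by (simp add: cube_eq_box open_box)

lemma cube_measurable [measurable]: "cube c r \<in> sets lebesgue"
  using open_cube[of c r] by (metis borel_open sets_completionI_sets sets_lborel)

lemma cube_subset_cube:
  fixes c c' :: "real ^ 'd"
  assumes "\<And>i. \<bar>c $ i - c' $ i\<bar> \<le> (r' - r) / (2 * sqrt (real CARD('d)))"
  shows "cube c r \<subseteq> cube c' r'"
proof
  fix x assume x: "x \<in> cube c r"
  have "\<bar>x $ i - c' $ i\<bar> < r' / (2 * sqrt (real CARD('d)))" for i
    using x assms[of i] unfolding cube_def by (auto simp: diff_divide_distrib dest!: spec[of _ i])
  then show "x \<in> cube c' r'" by (simp add: cube_def)
qed

lemma cube_mono: "r \<le> r' \<Longrightarrow> cube (c :: real ^ 'd) r \<subseteq> cube c r'"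
  by (rule cube_subset_cube) simp

lemma emeasure_cube:
  assumes "0 < r"
  shows "emeasure lebesgue (cube (c :: real ^ 'd) r)
    = ennreal ((r / sqrt (real CARD('d))) ^ CARD('d))"
proof -
  let ?e = "(\<chi> i. r / (2 * sqrt (real CARD('d)))) :: real ^ 'd"
  have ne: "cbox (c - ?e) (c + ?e) \<noteq> {}"
    using assms by (simp add: interval_ne_empty_cart)
  have le: "\<forall>b\<in>Basis. (c - ?e) \<bullet> b \<le> (c + ?e) \<bullet> b"
    using ne box_ne_empty(1) by blast
  have "emeasure lebesgue (cube c r) = emeasure lborel (box (c - ?e) (c + ?e))"
    by (simp add: cube_eq_box emeasure_completion)
  also have "\<dots> = ennreal (\<Prod>b\<in>Basis. (c + ?e - (c - ?e)) \<bullet> b)"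
    using le by (intro emeasure_lborel_box) auto
  also have "(\<Prod>b\<in>Basis. (c + ?e - (c - ?e)) \<bullet> b) = measure lborel (cbox (c - ?e) (c + ?e))"
    using le by (intro measure_lborel_cbox[symmetric]) auto
  also have "\<dots> = (\<Prod>i\<in>UNIV. (c + ?e) $ i - (c - ?e) $ i)"
    using ne by (rule content_cbox_cart)
  also have "\<dots> = (r / sqrt (real CARD('d))) ^ CARD('d)"
    by (simp add: field_simps)
  finally show ?thesis .
qed

lemma measure_cube:
  assumes "0 < r"
  shows "measure lebesgue (cube (c :: real ^ 'd) r) = (r / sqrt (real CARD('d))) ^ CARD('d)"
  using emeasure_cube[OF assms, of c] assms by (simp add: measure_def)

lemma cube_subset_ball:
  assumes "0 < r"
  shows "cube (c :: real ^ 'd) r \<subseteq> ball c r"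
proof
  fix x assume x: "x \<in> cube c r"
  have "norm (x - c) = L2_set (\<lambda>i. norm ((x - c) $ i)) UNIV" by (simp add: norm_vec_def)
  also have "\<dots> \<le> L2_set (\<lambda>i. r / (2 * sqrt (real CARD('d)))) (UNIV :: 'd set)"
    using x by (intro L2_set_mono) (auto simp: cube_def less_imp_le)
  also have "\<dots> = r / 2" using assms by (simp add: L2_set_constant)
  finally show "x \<in> ball c r" using assms by (simp add: dist_norm norm_minus_commute)
qed

lemma ball_subset_cube: "ball c r \<subseteq> cube (c :: real ^ 'd) (2 * sqrt (real CARD('d)) * r)"
proof
  fix x assume "x \<in> ball c r"
  then have "\<bar>x $ i - c $ i\<bar> < r" for i
    using component_le_norm_cart[of "x - c" i] by (simp add: dist_norm norm_minus_commute)
  then show "x \<in> cube c (2 * sqrt (real CARD('d)) * r)" by (simp add: cube_def)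
qed

section \<open>The maximal operator\<close>

text \<open>
  Two measures compare on a union as soon as they compare piece by piece, provided that the pieces
  on the right are disjoint.  With suitable densities this serves both the covering argument for the weak
  type bound, where \<open>A i\<close> is a dilate of \<open>B i\<close>, and the dyadic decomposition, where
  \<open>A i\<close> is a part of \<open>B i\<close>.
\<close>

lemma emeasure_UN_le_of_disjoint:
  assumes "countable C" and "pairwise (\<lambda>i j. disjnt (B i) (B j)) C"
    and "\<And>i. i \<in> C \<Longrightarrow> A i \<in> sets M" and "\<And>i. i \<in> C \<Longrightarrow> B i \<in> sets N"
    and le: "\<And>i. i \<in> C \<Longrightarrow> emeasure M (A i) \<le> emeasure N (B i)"
  shows "emeasure M (\<Union>i\<in>C. A i) \<le> emeasure N (\<Union>i\<in>C. B i)"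
proof -
  define J where "J = to_nat_on C ` C"
  define \<phi> where "\<phi> = from_nat_into C"
  have \<phi>J: "\<phi> ` J = C" and inj: "inj_on \<phi> J"
    using assms(1) by (auto simp: J_def \<phi>_def inj_on_def image_image)
  define A' where "A' n = (if n \<in> J then A (\<phi> n) else {})" for n
  define B' where "B' n = (if n \<in> J then B (\<phi> n) else {})" for n
  have mem: "n \<in> J \<Longrightarrow> \<phi> n \<in> C" for n using \<phi>J by blast
  have UA: "(\<Union>i\<in>C. A i) = (\<Union>n. A' n)" and UB: "(\<Union>i\<in>C. B i) = (\<Union>n. B' n)"
    using \<phi>J by (auto simp: A'_def B'_def split: if_splits)
  have "emeasure M (\<Union>n. A' n) \<le> (\<Sum>n. emeasure M (A' n))"
    using assms(3) mem by (intro emeasure_subadditive_countably) (auto simp: A'_def)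
  also have "\<dots> \<le> (\<Sum>n. emeasure N (B' n))"
    by (intro suminf_le) (auto simp: A'_def B'_def le mem)
  also have "\<dots> = emeasure N (\<Union>n. B' n)"
  proof (rule suminf_emeasure)
    show "range B' \<subseteq> sets N" using assms(4) mem by (auto simp: B'_def)
    show "disjoint_family B'"
      using assms(2) mem inj
      by (auto simp: disjoint_family_on_def B'_def pairwise_def disjnt_def inj_on_def) blast
  qed
  finally show ?thesis unfolding UA UB .
qed

text \<open>
  Clearing the denominator turns the ratio of extended reals into an inequality that is additive
  in the integral.
\<close>

lemma local_maximal_gt_iff:
  fixes g :: "real ^ 'd \<Rightarrow> real"
  assumes "0 \<le> l"
  shows "ennreal l < local_maximal B g x \<longleftrightarrow> (\<exists>c r. 0 < r \<and> x \<in> cube c r \<and> cube c r \<subseteq> B \<and>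
    ennreal l * emeasure lebesgue (cube c r) < (\<integral>\<^sup>+y\<in>cube c r. ennreal \<bar>g y\<bar> \<partial>lebesgue))"
proof -
  have *: "ennreal l < I / emeasure lebesgue (cube c r) \<longleftrightarrow> ennreal l * emeasure lebesgue (cube c r) < I"
    if "0 < r" for c :: "real ^ 'd" and r I
  proof -
    have V: "0 < (r / sqrt (real CARD('d))) ^ CARD('d)" using that by simp
    show ?thesis unfolding emeasure_cube[OF that] using V assms
      by (cases I) (auto simp: divide_ennreal ennreal_top_divide ennreal_mult[symmetric]
          ennreal_less_iff field_simps)
  qed
  show ?thesis unfolding local_maximal_def less_SUP_iff cubes_def using * by blast
qed

lemma open_level: "0 \<le> l \<Longrightarrow> open {x. ennreal l < local_maximal B g x}"
proof -
  assume l: "0 \<le> l"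
  have "{x. ennreal l < local_maximal B g x} = \<Union>{cube c r |c r. 0 < r \<and> cube c r \<subseteq> B \<and>
    ennreal l * emeasure lebesgue (cube c r) < (\<integral>\<^sup>+y\<in>cube c r. ennreal \<bar>g y\<bar> \<partial>lebesgue)}"
    unfolding local_maximal_gt_iff[OF l] by blast
  then show ?thesis using open_cube by (auto simp only: intro!: open_Union)
qed

lemma level_measurable [measurable]: "0 \<le> l \<Longrightarrow> {x. ennreal l < local_maximal B g x} \<in> sets lebesgue"
  using open_level[of l B g] by (metis borel_open sets_completionI_sets sets_lborel)

lemma average_le:
  assumes "0 \<le> l" "x \<in> cube c r" "0 < r" "local_maximal UNIV g x \<le> ennreal l"
  shows "(\<integral>\<^sup>+y\<in>cube c r. ennreal \<bar>g y\<bar> \<partial>lebesgue) \<le> ennreal l * emeasure lebesgue (cube c r)"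
  using assms local_maximal_gt_iff[OF assms(1), of UNIV g x] by (meson linorder_not_le subset_UNIV)

text \<open>
  The volume ratio in the covering lemma: a cube of diameter \<open>r\<close> lies in the ball of
  radius \<open>r\<close> about its centre, and five times that ball lies in the cube of diameter
  \<open>10 sqrt d r\<close>.
\<close>

definition weak_const :: "'d itself \<Rightarrow> real" where
  "weak_const _ = (10 * sqrt (real CARD('d))) ^ CARD('d)"

lemma weak_const_pos: "0 < weak_const TYPE('d::finite)"
  by (simp add: weak_const_def)

text \<open>
  The cubes with average above \<open>l\<close> cover the level set, and their diameters are bounded because \<open>g\<close>
  is integrable.  Vitali's lemma selects disjoint ones whose dilates still cover; each has measure
  at most the integral of \<open>|g|\<close> over it divided by \<open>l\<close>.
\<close>

lemma maximal_weak_type: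
  fixes g :: "real ^ 'd \<Rightarrow> real"
  assumes g [measurable]: "g \<in> borel_measurable lebesgue" and l: "0 < l"
    and fin: "(\<integral>\<^sup>+x. ennreal \<bar>g x\<bar> \<partial>lebesgue) < \<infinity>"
  shows "ennreal l * emeasure lebesgue {x. ennreal l < local_maximal UNIV g x}
    \<le> ennreal (weak_const TYPE('d)) * (\<integral>\<^sup>+x. ennreal \<bar>g x\<bar> \<partial>lebesgue)"
proof -
  let ?d = "sqrt (real CARD('d))"
  define I where "I = (\<integral>\<^sup>+x. ennreal \<bar>g x\<bar> \<partial>lebesgue)"
  define E where "E = {x. ennreal l < local_maximal UNIV g x}"
  define Q where "Q = (\<lambda>k :: (real ^ 'd) \<times> real. cube (fst k) (snd k))"
  define K where "K = {k. 0 < snd k \<and>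
    ennreal l * emeasure lebesgue (Q k) < (\<integral>\<^sup>+y\<in>Q k. ennreal \<bar>g y\<bar> \<partial>lebesgue)}"
  have cov: "E \<subseteq> (\<Union>k\<in>K. Q k)"
    using l by (auto simp: E_def K_def Q_def local_maximal_gt_iff) blast
  define t where "t = enn2real I / l"
  have I: "I = ennreal (enn2real I)" using fin by (simp add: I_def)
  have rb: "0 < snd k \<and> snd k \<le> ?d * (t + 1)" if "k \<in> K" for k
  proof -
    obtain c r where k: "k = (c, r)" by force
    have r: "0 < r" using that by (simp add: K_def k)
    have t0: "0 \<le> t" using l by (simp add: t_def)
    have "ennreal (l * (r / ?d) ^ CARD('d)) = ennreal l * emeasure lebesgue (Q k)"
      using r l by (simp add: Q_def k emeasure_cube ennreal_mult)
    also have "\<dots> \<le> (\<integral>\<^sup>+y\<in>Q k. ennreal \<bar>g y\<bar> \<partial>lebesgue)" using that by (simp add: K_def less_imp_le)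
    also have "\<dots> \<le> I" unfolding I_def by (intro nn_integral_mono) (auto simp: indicator_def)
    finally have "l * (r / ?d) ^ CARD('d) \<le> enn2real I"
      using l r by (subst (asm) I) (simp add: ennreal_le_iff)
    then have *: "(r / ?d) ^ CARD('d) \<le> t" using l by (simp add: t_def field_simps)
    have "r / ?d \<le> t + 1"
    proof (rule ccontr)
      assume n: "\<not> ?thesis"
      then have "1 \<le> r / ?d" using t0 by linarith
      then have "r / ?d \<le> (r / ?d) ^ CARD('d)" by (intro self_le_power) auto
      then show False using * n by linarith
    qed
    then show ?thesis using r by (simp add: k field_simps)
  qed
  have "E \<subseteq> (\<Union>k\<in>K. ball (fst k) (snd k))"
  proof (rule order_trans[OF cov], rule UN_mono[OF subset_refl])
    fix k assume "k \<in> K"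
    then show "Q k \<subseteq> ball (fst k) (snd k)" unfolding Q_def using rb by (intro cube_subset_ball) auto
  qed
  then obtain C where C: "countable C" "C \<subseteq> K"
    "pairwise (\<lambda>i j. disjnt (ball (fst i) (snd i)) (ball (fst j) (snd j))) C"
    and EC: "E \<subseteq> (\<Union>k\<in>C. ball (fst k) (5 * snd k))"
    by (rule Vitali_covering_lemma_balls[where B = "?d * (t + 1)"]) (use rb in auto)
  define Q5 where "Q5 = (\<lambda>k :: (real ^ 'd) \<times> real. cube (fst k) (2 * ?d * (5 * snd k)))"
  have pos: "k \<in> C \<Longrightarrow> 0 < snd k" for k using C rb by blast
  have dis: "pairwise (\<lambda>i j. disjnt (Q i) (Q j)) C"
  proof (unfold pairwise_def, intro ballI impI)
    fix i j assume ij: "i \<in> C" "j \<in> C" "i \<noteq> j"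
    then have "disjnt (ball (fst i) (snd i)) (ball (fst j) (snd j))" using C(3) by (simp add: pairwise_def)
    then show "disjnt (Q i) (Q j)"
      using cube_subset_ball pos ij disjnt_subset1 disjnt_subset2 unfolding Q_def by metis
  qed
  define N where "N = density lebesgue (\<lambda>x. ennreal (weak_const TYPE('d)) * ennreal \<bar>g x\<bar>)"
  define M where "M = density (lebesgue :: (real^'d) measure) (\<lambda>x. ennreal l)"
  have M: "emeasure M A = ennreal l * emeasure lebesgue A" if "A \<in> sets lebesgue" for A
    using that by (simp add: M_def emeasure_density_const)
  have Qs: "Q k \<in> sets lebesgue" "Q5 k \<in> sets lebesgue" for k by (simp_all add: Q_def Q5_def)
  have "ennreal l * emeasure lebesgue E \<le> ennreal l * emeasure lebesgue (\<Union>k\<in>C. Q5 k)"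
  proof (intro mult_left_mono emeasure_mono)
    show "E \<subseteq> (\<Union>k\<in>C. Q5 k)"
      by (rule order_trans[OF EC], rule UN_mono[OF subset_refl])
        (simp only: Q5_def ball_subset_cube)
    show "(\<Union>k\<in>C. Q5 k) \<in> sets lebesgue" using C(1) Qs by (intro sets.countable_UN') auto
  qed simp
  also have "\<dots> = emeasure M (\<Union>k\<in>C. Q5 k)"
    using C(1) Qs by (intro M[symmetric] sets.countable_UN') auto
  also have "\<dots> \<le> emeasure N (\<Union>k\<in>C. Q k)"
  proof (rule emeasure_UN_le_of_disjoint[OF C(1) dis])
    fix k assume k: "k \<in> C"
    show "Q5 k \<in> sets M" "Q k \<in> sets N" by (simp_all add: M_def N_def Qs)
    have s: "0 < snd k" using pos[OF k] .
    have "emeasure lebesgue (Q5 k) = ennreal ((2 * ?d * (5 * snd k) / ?d) ^ CARD('d))"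
      unfolding Q5_def using s by (intro emeasure_cube) simp
    also have "2 * ?d * (5 * snd k) / ?d = (10 * ?d) * (snd k / ?d)" by simp
    also have "ennreal (\<dots> ^ CARD('d)) = ennreal (weak_const TYPE('d)) * emeasure lebesgue (Q k)"
      unfolding Q_def emeasure_cube[OF s] power_mult_distrib weak_const_def
      using s by (intro ennreal_mult) auto
    finally have "emeasure M (Q5 k) = ennreal (weak_const TYPE('d)) * (ennreal l * emeasure lebesgue (Q k))"
      by (simp add: M Qs mult.left_commute)
    also have "\<dots> \<le> ennreal (weak_const TYPE('d)) * (\<integral>\<^sup>+y\<in>Q k. ennreal \<bar>g y\<bar> \<partial>lebesgue)"
      using k C by (intro mult_left_mono) (auto simp: K_def less_imp_le)
    also have "\<dots> = emeasure N (Q k)"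
      using Qs by (simp add: N_def emeasure_density nn_integral_cmult[symmetric] mult.assoc)
    finally show "emeasure M (Q5 k) \<le> emeasure N (Q k)" .
  qed
  also have "\<dots> \<le> emeasure N (space N)" by (rule emeasure_space)
  also have "\<dots> = ennreal (weak_const TYPE('d)) * I"
    by (simp add: N_def emeasure_density I_def nn_integral_cmult)
  finally show ?thesis by (simp add: E_def I_def)
qed

lemma floor_half_dyadic: "\<lfloor>2 ^ k * t / L\<rfloor> = \<lfloor>2 ^ Suc k * t / L\<rfloor> div (2 :: int)" for t L :: real
  using floor_divide_real_eq_div[of 2 "2 ^ Suc k * t / L"] by simp

section \<open>Decomposition of open sets into dyadic cubes\<close>

text \<open>
  An estimate on the maximal dyadic cubes in \<open>U\<close> sums to an estimate on \<open>U\<close>.  Maximality of a cube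
  enters through the point \<open>z\<close>: it lies outside \<open>U\<close> but in the closure of the parent
  \<open>cube y R\<close>.  The closure appears because the dyadic cubes are taken half-open, so that they
  partition \<open>U\<close> exactly, while the estimate is about open cubes; the two differ by a null set.
\<close>

lemma whitney_comparison:
  fixes U S :: "(real ^ 'd) set"
  assumes U: "open U" and fin: "emeasure lebesgue U < \<infinity>" and S: "S \<in> sets lebesgue"
    and \<delta>: "0 \<le> \<delta>"
    and local: "\<And>x y R z. 0 < R \<Longrightarrow> cube x (R / 2) \<in> subcubes y R \<Longrightarrow> cube x (R / 2) \<subseteq> U \<Longrightarrow>
       z \<notin> U \<Longrightarrow> (\<And>i. \<bar>z $ i - y $ i\<bar> \<le> R / (2 * sqrt (real CARD('d)))) \<Longrightarrow>
       emeasure lebesgue (S \<inter> cube x (R / 2)) \<le> ennreal \<delta> * emeasure lebesgue (cube x (R / 2))"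
  shows "emeasure lebesgue (S \<inter> U) \<le> ennreal \<delta> * emeasure lebesgue U"
proof -
  let ?d = "sqrt (real CARD('d))"
  (* L is the side length of the coarsest cubes.  As L >= 1, their volume is at least L, which
     exceeds the measure of U; hence every cube inside U has a dyadic parent. *)
  define L where "L = measure lebesgue U + 1"
  have L: "1 \<le> L" by (simp add: L_def)
  then have L0: "0 < L" by simp
  (* H k x is the half-open dyadic cube of side L / 2^k that contains x; the open cube with
     centre ce k x and diameter \<rho> k is its interior. *)
  define H where "H k x = {y :: real ^ 'd. \<forall>i. \<lfloor>2 ^ k * y $ i / L\<rfloor> = \<lfloor>2 ^ k * x $ i / L\<rfloor>}" for k :: nat and x
  define ce where "ce k x = (\<chi> i. (of_int \<lfloor>2 ^ k * x $ i / L\<rfloor> + 1 / 2) * L / 2 ^ k :: real ^ 'd)"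
    for k :: nat and x :: "real ^ 'd"
  define \<rho> where "\<rho> k = ?d * L / 2 ^ k" for k :: nat
  have \<rho>: "0 < \<rho> k" "\<rho> (Suc k) = \<rho> k / 2" for k using L0 by (simp_all add: \<rho>_def)
  have \<rho>h: "\<rho> k / (2 * ?d) = L / (2 * 2 ^ k)" for k by (simp add: \<rho>_def)
  have cubeH: "cube (ce k x) (\<rho> k) \<subseteq> H k x" for k x
  proof (clarsimp simp: cube_def H_def \<rho>h)
    fix y i assume "\<forall>i. \<bar>y $ i - ce k x $ i\<bar> < L / (2 * 2 ^ k)"
    then have "\<bar>y $ i - ce k x $ i\<bar> < L / (2 * 2 ^ k)" by blast
    then show "\<lfloor>2 ^ k * y $ i / L\<rfloor> = \<lfloor>2 ^ k * x $ i / L\<rfloor>"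
      using L0 unfolding floor_eq_iff by (auto simp: ce_def abs_less_iff field_simps)
  qed
  have Hclosed: "\<bar>y $ i - ce k x $ i\<bar> \<le> \<rho> k / (2 * ?d)" if "y \<in> H k x" for k x y i
  proof -
    have "\<lfloor>2 ^ k * y $ i / L\<rfloor> = \<lfloor>2 ^ k * x $ i / L\<rfloor>" using that by (simp add: H_def)
    then show ?thesis unfolding \<rho>h
      using L0 unfolding floor_eq_iff by (auto simp: ce_def abs_le_iff field_simps)
  qed
  have null: "H k x - cube (ce k x) (\<rho> k) \<in> null_sets lebesgue" for k x
  proof -
    let ?e = "(\<chi> i. \<rho> k / (2 * ?d)) :: real ^ 'd"
    have "H k x - cube (ce k x) (\<rho> k) \<subseteq> cbox (ce k x - ?e) (ce k x + ?e) - box (ce k x - ?e) (ce k x + ?e)"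
      using Hclosed[of _ k x] by (auto simp: cube_eq_box mem_box_cart abs_le_iff algebra_simps)
    then show ?thesis
      using negligible_frontier_interval negligible_subset negligible_iff_null_sets by blast
  qed
  have Hmeas [measurable]: "H k x \<in> sets lebesgue" for k x
  proof -
    have "H k x = cube (ce k x) (\<rho> k) \<union> (H k x - cube (ce k x) (\<rho> k))" using cubeH by blast
    then show ?thesis using null[of k x] cube_measurable by (metis null_setsD2 sets.Un)
  qed
  have nest1: "y \<in> H (Suc k) x \<Longrightarrow> y \<in> H k x" for k x y
    unfolding H_def mem_Collect_eq using floor_half_dyadic by metis
  have nest: "y \<in> H j x" if "y \<in> H k x" "j \<le> k" for j k x y
    using that(2,1) by (induction rule: inc_induct) (auto intro: nest1)
  have Heq: "H k y = H k x" if "y \<in> H k x" for k x y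
    using that by (auto simp: H_def)
  have self: "x \<in> H k x" for k x by (simp add: H_def)
  have sub: "cube (ce (Suc k) x) (\<rho> (Suc k)) \<in> subcubes (ce k x) (\<rho> k)" for k x
  proof -
    have "\<bar>ce (Suc k) x $ i - ce k x $ i\<bar> = \<rho> k / (4 * ?d)" for i
    proof -
      define a where "a = \<lfloor>2 ^ Suc k * x $ i / L\<rfloor>"
      define b where "b = a div 2"
      have b: "\<lfloor>2 ^ k * x $ i / L\<rfloor> = b" unfolding b_def a_def by (rule floor_half_dyadic)
      have "a = 2 * b \<or> a = 2 * b + 1" unfolding b_def by presburger
      then have r: "real_of_int a = 2 * real_of_int b \<or> real_of_int a = 2 * real_of_int b + 1" by auto
      have "ce (Suc k) x $ i - ce k x $ i = (real_of_int a - 2 * real_of_int b - 1 / 2) * (L / (2 * 2 ^ k))"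
      proof -
        have "ce (Suc k) x $ i = (real_of_int a + 1 / 2) * L / 2 ^ Suc k"
          and "ce k x $ i = (real_of_int b + 1 / 2) * L / 2 ^ k"
          by (simp_all only: ce_def a_def b vec_lambda_beta)
        then show ?thesis by (simp add: field_simps)
      qed
      moreover have "\<bar>real_of_int a - 2 * real_of_int b - 1 / 2\<bar> = 1 / 2" using r by auto
      ultimately have "\<bar>ce (Suc k) x $ i - ce k x $ i\<bar> = 1 / 2 * \<bar>L / (2 * 2 ^ k)\<bar>"
        by (simp only: abs_mult)
      then show ?thesis using L0 by (simp add: \<rho>_def)
    qed
    then show ?thesis unfolding subcubes_def \<rho>(2) by (intro CollectI exI[of _ "ce (Suc k) x"] conjI refl allI)
  qed
  have exk: "\<exists>k. H k x \<subseteq> U" if "x \<in> U" for x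
  proof -
    have "\<exists>e>0. ball x e \<subseteq> U" using U that by (simp only: open_contains_ball)
    then obtain e where e: "0 < e" "ball x e \<subseteq> U" by (elim exE conjE)
    have "\<exists>k. 2 * ?d * L / e < 2 ^ k" by (rule real_arch_pow) simp
    then obtain k where "2 * ?d * L / e < 2 ^ k" by (elim exE)
    then have k: "L / 2 ^ k < e / (2 * ?d)" using e by (simp add: field_simps)
    have "H k x \<subseteq> cube x e"
    proof
      fix y assume y: "y \<in> H k x"
      have "\<bar>y $ i - x $ i\<bar> < e / (2 * ?d)" for i
        using Hclosed[OF y, of i] Hclosed[OF self, of x i k] k unfolding \<rho>h by (simp add: abs_le_iff abs_less_iff)
      then show "y \<in> cube x e" by (simp add: cube_def)
    qed
    then show ?thesis using cube_subset_ball[OF e(1), of x] e(2) by blast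
  qed
  (* \<kappa> x is the level of the maximal dyadic cube in U that contains x; it is constant on that
     cube, so the maximal cubes are equal or disjoint. *)
  define \<kappa> where "\<kappa> x = (LEAST k. H k x \<subseteq> U)" for x
  have \<kappa>: "H (\<kappa> x) x \<subseteq> U" if "x \<in> U" for x
    unfolding \<kappa>_def using exk[OF that] by (rule LeastI_ex)
  have \<kappa>min: "\<not> H k x \<subseteq> U" if "k < \<kappa> x" for k x
    using that not_less_Least unfolding \<kappa>_def by blast
  have \<kappa>0: "\<kappa> x \<noteq> 0" if "x \<in> U" for x
  proof
    assume "\<kappa> x = 0"
    then have "cube (ce 0 x) (\<rho> 0) \<subseteq> U" using \<kappa>[OF that] cubeH[of 0 x] by auto
    then have "emeasure lebesgue (cube (ce 0 x) (\<rho> 0)) \<le> emeasure lebesgue U"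
      using U by (intro emeasure_mono) auto
    also have "\<dots> = ennreal (measure lebesgue U)"
      using fin by (intro emeasure_eq_ennreal_measure) auto
    finally have "L ^ CARD('d) \<le> measure lebesgue U"
      using L0 by (simp add: emeasure_cube \<rho> ennreal_le_iff) (simp add: \<rho>_def)
    moreover have "L \<le> L ^ CARD('d)" using L by (intro self_le_power) auto
    ultimately show False by (simp add: L_def)
  qed
  have \<kappa>eq: "\<kappa> y = \<kappa> x" if "y \<in> H (\<kappa> x) x" "x \<in> U" for x y
  proof (rule antisym)
    have "H (\<kappa> x) y \<subseteq> U" using Heq[OF that(1)] \<kappa>[OF that(2)] by simp
    then show "\<kappa> y \<le> \<kappa> x" unfolding \<kappa>_def[of y] by (rule Least_le)
    have "y \<in> U" using \<kappa> that by blast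
    show "\<kappa> x \<le> \<kappa> y"
    proof (rule ccontr)
      assume n: "\<not> ?thesis"
      then have "y \<in> H (\<kappa> y) x" using nest[OF that(1)] by simp
      then have "H (\<kappa> y) x \<subseteq> U" using Heq \<kappa>[OF \<open>y \<in> U\<close>] by metis
      then show False using \<kappa>min n by auto
    qed
  qed
  define C where "C = (\<lambda>x. H (\<kappa> x) x) ` U"
  have "C \<subseteq> range (\<lambda>(k, a :: int ^ 'd). {y. \<forall>i. \<lfloor>2 ^ k * y $ i / L\<rfloor> = a $ i})"
  proof
    fix Q assume "Q \<in> C"
    then obtain x where "Q = H (\<kappa> x) x" by (auto simp: C_def)
    then have "Q = (\<lambda>(k, a :: int ^ 'd). {y. \<forall>i. \<lfloor>2 ^ k * y $ i / L\<rfloor> = a $ i})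
      (\<kappa> x, \<chi> i. \<lfloor>2 ^ \<kappa> x * x $ i / L\<rfloor>)" by (simp add: H_def)
    then show "Q \<in> range (\<lambda>(k, a :: int ^ 'd). {y. \<forall>i. \<lfloor>2 ^ k * y $ i / L\<rfloor> = a $ i})" by blast
  qed
  then have countC: "countable C" by (rule countable_subset) simp
  have disC: "pairwise (\<lambda>P Q. disjnt P Q) C"
  proof (unfold pairwise_def, intro ballI impI)
    fix P Q assume "P \<in> C" "Q \<in> C" "P \<noteq> Q"
    then obtain x y where xy: "x \<in> U" "P = H (\<kappa> x) x" "y \<in> U" "Q = H (\<kappa> y) y"
      by (auto simp: C_def)
    have False if w: "w \<in> P" "w \<in> Q" for w
    proof -
      have "\<kappa> w = \<kappa> x" "H (\<kappa> x) w = P" "\<kappa> w = \<kappa> y" "H (\<kappa> y) w = Q"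
        using \<kappa>eq[of w x] \<kappa>eq[of w y] Heq[of w "\<kappa> x" x] Heq[of w "\<kappa> y" y] w xy by auto
      then show False using \<open>P \<noteq> Q\<close> by simp
    qed
    then show "disjnt P Q" unfolding disjnt_def by blast
  qed
  have UC: "\<Union>C = U" using \<kappa> self unfolding C_def by blast
  define N where "N = density (lebesgue :: (real ^ 'd) measure) (\<lambda>x. ennreal \<delta>)"
  have N: "emeasure N A = ennreal \<delta> * emeasure lebesgue A" if "A \<in> sets lebesgue" for A
    using that by (simp add: N_def emeasure_density_const)
  have "emeasure lebesgue (\<Union>Q\<in>C. S \<inter> Q) \<le> emeasure N (\<Union>Q\<in>C. Q)"
  proof (rule emeasure_UN_le_of_disjoint[OF countC disC])
    fix Q assume "Q \<in> C"
    then obtain x where x: "x \<in> U" "Q = H (\<kappa> x) x" by (auto simp: C_def)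
    obtain k where k: "\<kappa> x = Suc k" using \<kappa>0[OF x(1)] not0_implies_Suc by blast
    show QM: "Q \<in> sets N" and "S \<inter> Q \<in> sets lebesgue" using S by (auto simp: x N_def)
    let ?c = "cube (ce (Suc k) x) (\<rho> (Suc k))"
    obtain z where z: "z \<in> H k x" "z \<notin> U" using \<kappa>min[of k x] k by auto
    have "emeasure lebesgue (S \<inter> Q) \<le> emeasure lebesgue (S \<inter> ?c \<union> (Q - ?c))"
      using S by (intro emeasure_mono) (auto simp: x)
    also have "\<dots> = emeasure lebesgue (S \<inter> ?c)"
      using null S by (intro emeasure_Un_null_set) (auto simp: x k)
    also have "\<dots> \<le> ennreal \<delta> * emeasure lebesgue ?c"
      unfolding \<rho>(2)
    proof (rule local[of "\<rho> k" _ "ce k x" z])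
      show "cube (ce (Suc k) x) (\<rho> k / 2) \<in> subcubes (ce k x) (\<rho> k)" using sub[of k x] \<rho>(2) by simp
      show "cube (ce (Suc k) x) (\<rho> k / 2) \<subseteq> U" using cubeH[of "Suc k" x] \<kappa>[OF x(1)] k \<rho>(2) by simp
    qed (use \<rho>(1) z Hclosed[OF z(1)] in auto)
    also have "\<dots> \<le> ennreal \<delta> * emeasure lebesgue Q"
      using cubeH[of "Suc k" x] by (intro mult_left_mono emeasure_mono) (auto simp: x k)
    also have "\<dots> = emeasure N Q" using N[of Q] QM by (simp add: N_def)
    finally show "emeasure lebesgue (S \<inter> Q) \<le> emeasure N Q" .
  qed
  moreover have "(\<Union>Q\<in>C. S \<inter> Q) = S \<inter> U" "(\<Union>Q\<in>C. Q) = U" using UC by auto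
  ultimately show ?thesis using N[of U] U by (simp only: borel_open sets_completionI_sets sets_lborel)
qed

section \<open>Maximal function and level sets\<close>

text \<open>
  The part of \<open>h\<close> below \<open>l/2\<close> contributes at most \<open>l/2\<close> to any average, so where the maximal function
  of \<open>h\<close> exceeds \<open>l\<close>, that of the part above \<open>l/2\<close> exceeds \<open>l/2\<close>.  This localisation is what allows
  weak bounds to be summed over \<open>l\<close> to a bound for \<open>\<integral> |h|\<^sup>s\<close>.
\<close>

lemma maximal_truncated_weak_type:
  fixes h :: "real ^ 'd \<Rightarrow> real"
  assumes h [measurable]: "h \<in> borel_measurable lebesgue" and l: "0 < l"
    and fin: "(\<integral>\<^sup>+x. ennreal \<bar>h x\<bar> \<partial>lebesgue) < \<infinity>"
  shows "ennreal l * emeasure lebesgue {x. ennreal l < local_maximal UNIV h x}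
    \<le> ennreal (2 * weak_const TYPE('d)) * (\<integral>\<^sup>+x\<in>{x. l / 2 < \<bar>h x\<bar>}. ennreal \<bar>h x\<bar> \<partial>lebesgue)"
proof -
  define h1 where "h1 x = h x * indicator {x. l / 2 < \<bar>h x\<bar>} x" for x
  have h1 [measurable]: "h1 \<in> borel_measurable lebesgue" unfolding h1_def by measurable
  have h1I: "(\<integral>\<^sup>+x. ennreal \<bar>h1 x\<bar> \<partial>lebesgue) = (\<integral>\<^sup>+x\<in>{x. l / 2 < \<bar>h x\<bar>}. ennreal \<bar>h x\<bar> \<partial>lebesgue)"
    unfolding h1_def by (intro nn_integral_cong) (auto simp: indicator_def)
  also have "\<dots> \<le> (\<integral>\<^sup>+x. ennreal \<bar>h x\<bar> \<partial>lebesgue)"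
    by (intro nn_integral_mono) (auto simp: indicator_def)
  finally have fin1: "(\<integral>\<^sup>+x. ennreal \<bar>h1 x\<bar> \<partial>lebesgue) < \<infinity>" using fin by (rule le_less_trans)
  have sub: "{x. ennreal l < local_maximal UNIV h x} \<subseteq> {x. ennreal (l / 2) < local_maximal UNIV h1 x}"
  proof safe
    fix x assume "ennreal l < local_maximal UNIV h x"
    then obtain c r where r: "0 < r" "x \<in> cube c r"
      and gt: "ennreal l * emeasure lebesgue (cube c r) < (\<integral>\<^sup>+y\<in>cube c r. ennreal \<bar>h y\<bar> \<partial>lebesgue)"
      using l by (auto simp: local_maximal_gt_iff)
    define V where "V = (r / sqrt (real CARD('d))) ^ CARD('d)"
    have V: "emeasure lebesgue (cube c r) = ennreal V" "0 < V" using r by (simp_all add: emeasure_cube V_def)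
    have "(\<integral>\<^sup>+y\<in>cube c r. ennreal \<bar>h y\<bar> \<partial>lebesgue)
      \<le> (\<integral>\<^sup>+y\<in>cube c r. (ennreal \<bar>h1 y\<bar> + ennreal (l / 2)) \<partial>lebesgue)"
      using l by (intro nn_integral_mono) (auto simp: h1_def indicator_def intro!: ennreal_leI)
    also have "\<dots> = (\<integral>\<^sup>+y\<in>cube c r. ennreal \<bar>h1 y\<bar> \<partial>lebesgue) + ennreal (l / 2 * V)"
      using l V ennreal_mult[of "l / 2" V]
      by (simp add: distrib_right nn_integral_add nn_integral_cmult_indicator)
    finally have "ennreal (l * V) < (\<integral>\<^sup>+y\<in>cube c r. ennreal \<bar>h1 y\<bar> \<partial>lebesgue) + ennreal (l / 2 * V)"
      using gt l V by (simp add: ennreal_mult)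
    then have "ennreal (l / 2 * V) < (\<integral>\<^sup>+y\<in>cube c r. ennreal \<bar>h1 y\<bar> \<partial>lebesgue)"
      using l V(2) by (cases "\<integral>\<^sup>+y\<in>cube c r. ennreal \<bar>h1 y\<bar> \<partial>lebesgue")
        (auto simp: ennreal_plus[symmetric] ennreal_less_iff simp del: ennreal_plus)
    then have "ennreal (l / 2) * emeasure lebesgue (cube c r) < (\<integral>\<^sup>+y\<in>cube c r. ennreal \<bar>h1 y\<bar> \<partial>lebesgue)"
      using l V ennreal_mult[of "l / 2" V] by simp
    then show "ennreal (l / 2) < local_maximal UNIV h1 x"
      using r l by (auto simp: local_maximal_gt_iff)
  qed
  have l2: "ennreal l = 2 * ennreal (l / 2)"
    using l by (simp add: ennreal_mult'[symmetric] ennreal_numeral[symmetric] del: ennreal_numeral)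
  have "ennreal l * emeasure lebesgue {x. ennreal l < local_maximal UNIV h x}
    \<le> 2 * (ennreal (l / 2) * emeasure lebesgue {x. ennreal (l / 2) < local_maximal UNIV h1 x})"
    unfolding l2[symmetric] mult.assoc[symmetric]
    using sub l by (intro mult_left_mono emeasure_mono) auto
  also have "\<dots> \<le> 2 * (ennreal (weak_const TYPE('d)) * (\<integral>\<^sup>+x. ennreal \<bar>h1 x\<bar> \<partial>lebesgue))"
    using l fin1 by (intro mult_left_mono maximal_weak_type) auto
  also have "\<dots> = ennreal (2 * weak_const TYPE('d)) * (\<integral>\<^sup>+x. ennreal \<bar>h1 x\<bar> \<partial>lebesgue)"
    using weak_const_pos[where 'd='d] by (simp add: ennreal_mult mult.assoc)
  finally show ?thesis unfolding h1I .
qed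

lemma level_emeasure_finite:
  fixes h :: "real ^ 'd \<Rightarrow> real"
  assumes "h \<in> borel_measurable lebesgue" and l: "0 < l" and "(\<integral>\<^sup>+x. ennreal \<bar>h x\<bar> \<partial>lebesgue) < \<infinity>"
  shows "emeasure lebesgue {x. ennreal l < local_maximal UNIV h x} < \<infinity>"
proof -
  have "ennreal (weak_const TYPE('d)) * (\<integral>\<^sup>+x. ennreal \<bar>h x\<bar> \<partial>lebesgue) < \<infinity>"
    using assms(3) by (simp add: ennreal_mult_less_top)
  with maximal_weak_type[OF assms]
  have "ennreal l * emeasure lebesgue {x. ennreal l < local_maximal UNIV h x} < \<infinity>"
    by (rule le_less_trans)
  then show ?thesis using l by (auto simp: ennreal_mult_less_top)
qed

text \<open>
  A form of Lebesgue differentiation.  Let \<open>S\<close> be the set where \<open>|h| > l' > l\<close> but the maximal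
  function is at most \<open>l\<close>.  Every cube that meets \<open>S\<close> has average at most \<open>l\<close>, so \<open>S\<close> fills at most the
  fraction \<open>l/l' < 1\<close> of it.  Summing over the dyadic cubes of an open set \<open>T \<supseteq> S\<close> gives
  \<open>|S| \<le> (l/l') |T|\<close>, which is impossible for \<open>T\<close> close to \<open>S\<close> unless \<open>S\<close> is null.
\<close>

lemma emeasure_level_le_maximal:
  fixes h :: "real ^ 'd \<Rightarrow> real"
  assumes h [measurable]: "h \<in> borel_measurable lebesgue" and l: "0 < l"
    and fin: "(\<integral>\<^sup>+x. ennreal \<bar>h x\<bar> \<partial>lebesgue) < \<infinity>"
  shows "emeasure lebesgue {x. l < \<bar>h x\<bar>} \<le> emeasure lebesgue {x. ennreal l < local_maximal UNIV h x}"
proof -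
  let ?E = "{x. ennreal l < local_maximal UNIV h x}"
  define S where "S l' = {x. l' < \<bar>h x\<bar>} - ?E" for l'
  have E [measurable]: "?E \<in> sets lebesgue" using l by (intro level_measurable) simp
  have S [measurable]: "S l' \<in> sets lebesgue" for l'
  proof -
    have "{x \<in> space lebesgue. l' < \<bar>h x\<bar>} \<in> sets lebesgue" by measurable
    then show ?thesis unfolding S_def using E by simp
  qed
  have le_int: "ennreal l' * emeasure lebesgue (S l' \<inter> A) \<le> (\<integral>\<^sup>+x\<in>A. ennreal \<bar>h x\<bar> \<partial>lebesgue)"
    if A [measurable]: "A \<in> sets lebesgue" for A l'
  proof -
    have "ennreal l' * emeasure lebesgue (S l' \<inter> A) = (\<integral>\<^sup>+x. ennreal l' * indicator (S l' \<inter> A) x \<partial>lebesgue)"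
      by (subst nn_integral_cmult_indicator) auto
    also have "\<dots> \<le> (\<integral>\<^sup>+x\<in>A. ennreal \<bar>h x\<bar> \<partial>lebesgue)"
      by (intro nn_integral_mono) (auto simp: S_def indicator_def intro!: ennreal_leI)
    finally show ?thesis .
  qed
  have null: "emeasure lebesgue (S l') = 0" if l': "l < l'" for l'
  proof (rule ccontr)
    assume pos: "emeasure lebesgue (S l') \<noteq> 0"
    have "ennreal l' * emeasure lebesgue (S l') < \<infinity>"
      using le_int[of UNIV l'] fin by (auto intro: le_less_trans)
    then have "emeasure lebesgue (S l') < \<infinity>" using l l' by (auto simp: ennreal_mult_less_top)
    then obtain m where m: "emeasure lebesgue (S l') = ennreal m" "0 \<le> m"
      by (cases "emeasure lebesgue (S l')") auto
    with pos have m0: "0 < m" by (cases "m = 0") auto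
    (* the value of e for which l / l' * (m + e) = m *)
    define e where "e = m * (l' - l) / l"
    have e: "0 < e" using m0 l l' by (simp add: e_def)
    obtain T where T: "open T" "S l' \<subseteq> T" "T - S l' \<in> lmeasurable" "emeasure lebesgue (T - S l') < ennreal e"
      using sets_lebesgue_outer_open[OF S e] by blast
    have Ts: "T \<in> sets lebesgue" using T(1) by simp
    have "T = S l' \<union> (T - S l')" using T(2) by blast
    then have "emeasure lebesgue T = ennreal m + emeasure lebesgue (T - S l')"
      using m(1) S Ts by (metis Diff_disjoint plus_emeasure sets.Diff)
    moreover obtain t where t: "emeasure lebesgue (T - S l') = ennreal t" "0 \<le> t" "t < e"
      using T(4) by (cases "emeasure lebesgue (T - S l')") (auto simp: ennreal_less_iff)
    ultimately have Tm: "emeasure lebesgue T = ennreal (m + t)" using m(2) by simp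
    have "emeasure lebesgue (S l' \<inter> T) \<le> ennreal (l / l') * emeasure lebesgue T"
    proof (rule whitney_comparison[OF T(1) _ S])
      show "emeasure lebesgue T < \<infinity>" using Tm by simp
      show "0 \<le> l / l'" using l l' by simp
      fix x y :: "real ^ 'd" and R :: real
      assume R: "0 < R"
      let ?Q = "cube x (R / 2)"
      show "emeasure lebesgue (S l' \<inter> ?Q) \<le> ennreal (l / l') * emeasure lebesgue ?Q"
      proof (cases "S l' \<inter> ?Q = {}")
        case True then show ?thesis by simp
      next
        case False
        then obtain w where "w \<in> S l' \<inter> ?Q" by blast
        then have w: "w \<in> ?Q" "local_maximal UNIV h w \<le> ennreal l" by (auto simp: S_def not_less)
        have "ennreal l' * emeasure lebesgue (S l' \<inter> ?Q) \<le> ennreal l * emeasure lebesgue ?Q"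
          using le_int[of ?Q l'] average_le[OF _ w(1) _ w(2)] l R by (auto intro: order_trans)
        then have "ennreal (1 / l') * (ennreal l' * emeasure lebesgue (S l' \<inter> ?Q))
          \<le> ennreal (1 / l') * (ennreal l * emeasure lebesgue ?Q)" by (rule mult_left_mono) simp
        then show ?thesis using l l' by (simp add: mult.assoc[symmetric] ennreal_mult[symmetric])
      qed
    qed
    moreover have "S l' \<inter> T = S l'" using T(2) by blast
    moreover have "ennreal (l / l') * ennreal (m + t) = ennreal (l / l' * (m + t))"
      using l l' m t by (intro ennreal_mult[symmetric]) auto
    ultimately have "ennreal m \<le> ennreal (l / l' * (m + t))" by (simp only: Tm m(1))
    then have "m \<le> l / l' * (m + t)" using l l' m t by (simp add: ennreal_le_iff)
    also have "\<dots> < l / l' * (m + e)" using t l l' by (intro mult_strict_left_mono) auto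
    also have "\<dots> = m" using l l' by (simp add: e_def field_simps)
    finally show False by simp
  qed
  have "S l \<subseteq> (\<Union>n. S (l + 1 / real (Suc n)))"
  proof
    fix x assume x: "x \<in> S l"
    then have "0 < \<bar>h x\<bar> - l" by (simp add: S_def)
    then obtain n where "1 / real (Suc n) < \<bar>h x\<bar> - l" using nat_approx_posE by blast
    then show "x \<in> (\<Union>n. S (l + 1 / real (Suc n)))" using x by (auto simp: S_def intro!: exI[of _ n])
  qed
  moreover have "(\<Union>n. S (l + 1 / real (Suc n))) \<in> null_sets lebesgue"
    by (intro null_sets_UN null_setsI null S) simp
  ultimately have "S l \<in> null_sets lebesgue" using S null_sets_subset by blast
  have "emeasure lebesgue {x. l < \<bar>h x\<bar>} \<le> emeasure lebesgue (?E \<union> S l)"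
    by (rule emeasure_mono[OF _ sets.Un[OF E S]]) (auto simp: S_def)
  also have "\<dots> = emeasure lebesgue ?E"
    using \<open>S l \<in> null_sets lebesgue\<close> by (intro emeasure_Un_null_set E)
  finally show ?thesis .
qed

section \<open>The good-\<open>\<lambda>\<close> inequality\<close>

lemma set_integral_eq_nn_integral:
  fixes h :: "'a \<Rightarrow> real"
  assumes "integrable M h" and "\<And>x. 0 \<le> h x" and "A \<in> sets M"
  shows "ennreal (LINT x:A|M. h x) = (\<integral>\<^sup>+x\<in>A. ennreal \<bar>h x\<bar> \<partial>M)"
proof -
  have "(\<integral>\<^sup>+x\<in>A. ennreal \<bar>h x\<bar> \<partial>M) = (\<integral>\<^sup>+x. ennreal (indicator A x *\<^sub>R h x) \<partial>M)"
    using assms(2) by (intro nn_integral_cong) (auto simp: indicator_def)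
  also have "\<dots> = ennreal (\<integral>x. indicator A x *\<^sub>R h x \<partial>M)"
    using assms by (intro nn_integral_eq_integral integrable_mult_indicator) (auto simp: indicator_def)
  finally show ?thesis by (simp add: set_lebesgue_integral_def)
qed

lemma set_integral_cube_le:
  fixes h :: "real ^ 'd \<Rightarrow> real"
  assumes "integrable lebesgue h" "\<And>x. 0 \<le> h x" and l: "0 \<le> l" and r: "0 < r"
    and "x \<in> cube c r" "local_maximal UNIV h x \<le> ennreal l"
  shows "(LINT y:cube c r|lebesgue. h y) \<le> l * measure lebesgue (cube c r)"
proof -
  have "ennreal (LINT y:cube c r|lebesgue. h y) \<le> ennreal l * emeasure lebesgue (cube c r)"
    using assms average_le[OF l assms(5) r assms(6)] by (subst set_integral_eq_nn_integral) auto
  also have "\<dots> = ennreal (l * measure lebesgue (cube c r))"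
    using l r by (simp add: emeasure_cube measure_cube ennreal_mult)
  finally show ?thesis using l by (subst (asm) ennreal_le_iff) auto
qed

lemma subcube_subset:
  assumes "0 < R" "cube x (R / 2) \<in> subcubes y R"
  shows "cube x (R / 2) \<subseteq> cube (y :: real ^ 'd) R"
proof -
  from assms(2) obtain z where z: "cube x (R / 2) = cube z (R / 2)"
    "\<And>i. \<bar>z $ i - y $ i\<bar> = R / (4 * sqrt (real CARD('d)))" by (auto simp: subcubes_def)
  show ?thesis unfolding z(1) by (rule cube_subset_cube) (simp add: z(2))
qed

text \<open>
  The weak-type hypothesis for \<open>F = |E\<^sub>0 f|\<^sup>2\<close> and \<open>G = |E\<^sub>0 T(f)|\<^sup>2\<close>, which live on the whole space.
  A subcube of \<open>cube y R\<close> has diameter \<open>R/2\<close>, so \<open>R\<close> is the only size parameter.  The estimate is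
  stated also for parents whose double misses the domain: there \<open>G\<close> and its maximal function vanish.
\<close>

definition scalar_weak_type ::
  "real \<Rightarrow> real \<Rightarrow> real \<Rightarrow> (real ^ 'd \<Rightarrow> real) \<Rightarrow> (real ^ 'd \<Rightarrow> real) \<Rightarrow> bool" where
  "scalar_weak_type K q \<alpha> F G \<longleftrightarrow>
     (\<forall>\<iota> > 0. \<forall>x y. \<forall>R > 0. cube x (R / 2) \<in> subcubes y R \<longrightarrow>
       measure lebesgue {w \<in> cube x (R / 2). local_maximal (cube y (2 * R)) G w > ennreal \<iota>}
       \<le> K / \<iota> * (LINT x:cube y (2 * \<alpha> * R)|lebesgue. F x)
          + K * measure lebesgue (cube x (R / 2)) / \<iota> powr (q / 2) *
            (sqrt (1 / measure lebesgue (cube x (R / 2)) * (LINT x:cube y (2 * \<alpha> * R)|lebesgue. G x))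
             + (SUP Q' \<in> {Q' \<in> cubes. cube y (2 * R) \<subseteq> Q'}.
                  sqrt (1 / measure lebesgue Q' * (LINT x:Q'|lebesgue. F x)))) powr q)"

text \<open>
  In the weak-type hypothesis at height \<open>A l\<close>, the averages of \<open>G\<close> and \<open>F\<close> over
  \<open>2 \<alpha> Q*\<close> are at most \<open>l\<close> and \<open>\<gamma> l\<close>, since this cube contains \<open>z0\<close> and \<open>z1\<close>; every \<open>Q'\<close> in the
  supremum contains \<open>z1\<close> as well.  The powers of \<open>l\<close> cancel, and \<open>(4 \<alpha>)\<^sup>d\<close> is the ratio of
  the volumes of \<open>2 \<alpha> Q*\<close> and \<open>Q\<close>.
\<close>

lemma local_level_estimate:
  fixes F G :: "real ^ 'd \<Rightarrow> real" and x y :: "real ^ 'd"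
  assumes F: "integrable lebesgue F" "\<And>x. 0 \<le> F x" and G: "integrable lebesgue G" "\<And>x. 0 \<le> G x"
    and pos: "0 < l" "0 < A" "0 < K" "0 < q" "1 < \<alpha>" "0 < R" and \<gamma>: "0 < \<gamma>" "\<gamma> \<le> 1"
    and sub: "cube x (R / 2) \<in> subcubes y R"
    and z0: "z0 \<in> cube y (2 * \<alpha> * R)" "local_maximal UNIV G z0 \<le> ennreal l"
    and z1: "z1 \<in> cube x (R / 2)" "local_maximal UNIV F z1 \<le> ennreal (\<gamma> * l)"
    and est: "scalar_weak_type K q \<alpha> F G"
  shows "measure lebesgue {w \<in> cube x (R / 2). local_maximal (cube y (2 * R)) G w > ennreal (A * l)}
    \<le> (K * (4 * \<alpha>) ^ CARD('d) * \<gamma> / A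
      + K * (sqrt ((4 * \<alpha>) ^ CARD('d)) + 1) powr q * A powr (- (q / 2))) * measure lebesgue (cube x (R / 2))"
proof -
  let ?d = "sqrt (real CARD('d))"
  define X where "X = measure lebesgue {w \<in> cube x (R / 2). local_maximal (cube y (2 * R)) G w > ennreal (A * l)}"
  define c where "c = (4 * \<alpha>) ^ CARD('d)"
  define V where "V = measure lebesgue (cube x (R / 2))"
  define IF where "IF = (LINT x:cube y (2 * \<alpha> * R)|lebesgue. F x)"
  define IG where "IG = (LINT x:cube y (2 * \<alpha> * R)|lebesgue. G x)"
  define h where "h Q' = sqrt (1 / measure lebesgue Q' * (LINT x:Q'|lebesgue. F x))" for Q'
  define QQ where "QQ = {Q' \<in> cubes. cube y (2 * R) \<subseteq> Q'}"
  have c0: "0 < c" using pos by (simp add: c_def)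
  have V: "0 < V" using pos by (simp add: V_def measure_cube)
  have "measure lebesgue (cube y (2 * \<alpha> * R)) = (2 * \<alpha> * R / ?d) ^ CARD('d)"
    using pos by (intro measure_cube) simp
  also have "2 * \<alpha> * R / ?d = (4 * \<alpha>) * (R / 2 / ?d)" by simp
  also have "\<dots> ^ CARD('d) = c * V" using pos by (simp only: power_mult_distrib c_def V_def) (simp add: measure_cube)
  finally have big: "measure lebesgue (cube y (2 * \<alpha> * R)) = c * V" .
  have Qsub: "cube x (R / 2) \<subseteq> cube y (2 * R)"
    using subcube_subset[OF _ sub] cube_mono[of R "2 * R" y] pos by auto
  have "z1 \<in> cube y (2 * \<alpha> * R)"
    using z1(1) Qsub cube_mono[of "2 * R" "2 * \<alpha> * R" y] pos by auto
  then have IF: "IF \<le> \<gamma> * l * (c * V)"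
    unfolding IF_def big[symmetric] using F pos \<gamma> z1(2) by (intro set_integral_cube_le) auto
  have IG: "IG \<le> l * (c * V)"
    unfolding IG_def big[symmetric] using G pos z0 by (intro set_integral_cube_le) auto
  have h: "h Q' \<le> sqrt l" if "Q' \<in> QQ" for Q'
  proof -
    have "Q' \<in> cubes" using that by (simp add: QQ_def)
    then obtain c' r' where Q': "Q' = cube c' r'" "0 < r'" unfolding cubes_def by blast
    have "z1 \<in> Q'" using that z1(1) Qsub by (auto simp: QQ_def)
    then have "(LINT x:Q'|lebesgue. F x) \<le> \<gamma> * l * measure lebesgue Q'"
      unfolding Q'(1) using F pos \<gamma> z1(2) Q' by (intro set_integral_cube_le) auto
    moreover have "0 < measure lebesgue Q'" using Q' by (simp add: measure_cube)
    ultimately have "1 / measure lebesgue Q' * (LINT x:Q'|lebesgue. F x) \<le> \<gamma> * l"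
      by (simp add: field_simps)
    also have "\<dots> \<le> l" using \<gamma> pos by (simp add: mult_left_le_one_le)
    finally show ?thesis unfolding h_def by (rule real_sqrt_le_mono)
  qed
  have "cube y (2 * R) \<in> cubes"
    unfolding cubes_def using pos by (intro CollectI exI[of _ y] exI[of _ "2 * R"]) simp
  then have ne: "cube y (2 * R) \<in> QQ" by (simp add: QQ_def)
  have sup_le: "(SUP Q' \<in> QQ. h Q') \<le> sqrt l" using ne h by (intro cSUP_least) auto
  have "0 \<le> h (cube y (2 * R))"
    unfolding h_def set_lebesgue_integral_def using F by (simp add: integral_nonneg_AE indicator_def)
  also have "\<dots> \<le> (SUP Q' \<in> QQ. h Q')" using ne h by (intro cSUP_upper bdd_aboveI2) auto
  finally have sup_ge: "0 \<le> (SUP Q' \<in> QQ. h Q')" .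
  have "1 / V * IG \<le> c * l" using IG V by (simp add: field_simps)
  then have sq: "sqrt (1 / V * IG) \<le> sqrt c * sqrt l" by (metis real_sqrt_le_mono real_sqrt_mult)
  have "0 \<le> IG"
    unfolding IG_def set_lebesgue_integral_def using G by (simp add: integral_nonneg_AE indicator_def)
  then have sq0: "0 \<le> sqrt (1 / V * IG)" using V by simp
  have "(sqrt (1 / V * IG) + (SUP Q' \<in> QQ. h Q')) powr q \<le> ((sqrt c + 1) * sqrt l) powr q"
    using sq0 sq sup_le sup_ge pos by (intro powr_mono2) (auto simp: algebra_simps)
  also have "\<dots> = (sqrt c + 1) powr q * l powr (q / 2)"
    using c0 pos by (simp add: powr_mult powr_half_sqrt[symmetric] powr_powr)
  finally have main: "(sqrt (1 / V * IG) + (SUP Q' \<in> QQ. h Q')) powr q \<le> (sqrt c + 1) powr q * l powr (q / 2)" .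
  have "X \<le> K / (A * l) * IF + K * V / (A * l) powr (q / 2) * (sqrt (1 / V * IG) + (SUP Q' \<in> QQ. h Q')) powr q"
    using est[unfolded scalar_weak_type_def, rule_format, of "A * l" R x y] pos sub
    unfolding X_def IF_def IG_def V_def QQ_def h_def by simp
  also have "\<dots> \<le> K / (A * l) * (\<gamma> * l * (c * V))
      + K * V / (A * l) powr (q / 2) * ((sqrt c + 1) powr q * l powr (q / 2))"
    using IF main pos V by (intro add_mono mult_left_mono) auto
  also have "K / (A * l) * (\<gamma> * l * (c * V)) = K * c * \<gamma> / A * V" using pos by simp
  also have "K * V / (A * l) powr (q / 2) * ((sqrt c + 1) powr q * l powr (q / 2))
    = K * (sqrt c + 1) powr q * A powr (- (q / 2)) * V"
    using pos by (simp add: powr_mult powr_minus field_simps)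
  finally show ?thesis unfolding X_def c_def V_def by (simp add: algebra_simps)
qed

text \<open>
  Off the set \<open>B\<close> where the maximal function of \<open>F\<close> is large, each maximal dyadic cube of
  \<open>{M G > l}\<close> either contributes nothing or contains a point \<open>z1\<close> as in the local estimate; the
  point \<open>z0\<close> is supplied by maximality.  The dilation by \<open>\<alpha> > 1\<close> makes the open cube
  \<open>2 \<alpha> Q*\<close> contain the closure of the parent, where \<open>z0\<close> lies.
\<close>

lemma good_lambda:
  fixes F G :: "real ^ 'd \<Rightarrow> real"
  assumes F: "integrable lebesgue F" "\<And>x. 0 \<le> F x" and G: "integrable lebesgue G" "\<And>x. 0 \<le> G x"
    and pos: "0 < K" "0 < q" "1 < \<alpha>" and \<gamma>: "0 < \<gamma>" "\<gamma> \<le> 1" and A: "5 ^ CARD('d) \<le> A"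
    and small: "K * (4 * \<alpha>) ^ CARD('d) * \<gamma> / A
      + K * (sqrt ((4 * \<alpha>) ^ CARD('d)) + 1) powr q * A powr (- (q / 2)) \<le> \<delta>"
    and est: "scalar_weak_type K q \<alpha> F G"
    and l: "0 < l"
  shows "emeasure lebesgue {x. ennreal (A * l) < local_maximal UNIV G x}
    \<le> ennreal \<delta> * emeasure lebesgue {x. ennreal l < local_maximal UNIV G x}
      + emeasure lebesgue {x. ennreal (\<gamma> * l) < local_maximal UNIV F x}"
proof -
  let ?d = "sqrt (real CARD('d))"
  define U where "U = {x. ennreal l < local_maximal UNIV G x}"
  define W where "W = {x. ennreal (A * l) < local_maximal UNIV G x}"
  define B where "B = {x. ennreal (\<gamma> * l) < local_maximal UNIV F x}"
  have "(1 :: real) \<le> 5 ^ CARD('d)" by simp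
  then have A1: "1 \<le> A" using A by linarith
  then have A0: "0 < A" by simp
  have Al: "l \<le> A * l" "0 < A * l" using A1 l by auto
  have "0 < K * (4 * \<alpha>) ^ CARD('d) * \<gamma> / A" using pos \<gamma> A0 by simp
  moreover have "0 \<le> K * (sqrt ((4 * \<alpha>) ^ CARD('d)) + 1) powr q * A powr (- (q / 2))" using pos by simp
  ultimately have \<delta>: "0 \<le> \<delta>" using small by linarith
  have U: "U \<in> sets lebesgue" and W: "W \<in> sets lebesgue" and B: "B \<in> sets lebesgue"
    unfolding U_def W_def B_def using l Al \<gamma> by (auto intro!: level_measurable)
  have WU: "W \<subseteq> U" unfolding W_def U_def using Al by (auto intro: le_less_trans ennreal_leI)
  have "emeasure lebesgue ((W - B) \<inter> U) \<le> ennreal \<delta> * emeasure lebesgue U"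
  proof (rule whitney_comparison)
    show "open U" unfolding U_def using l by (intro open_level) simp
    show "emeasure lebesgue U < \<infinity>" unfolding U_def using G l
      by (intro level_emeasure_finite) (auto simp: integrable_iff_bounded)
    show "W - B \<in> sets lebesgue" using W B by simp
    show "0 \<le> \<delta>" by (rule \<delta>)
    fix x y :: "real ^ 'd" and R z
    assume R: "0 < R" and sub: "cube x (R / 2) \<in> subcubes y R" and z: "z \<notin> U"
      and zy: "\<And>i. \<bar>z $ i - y $ i\<bar> \<le> R / (2 * sqrt (real CARD('d)))"
    have Mz: "local_maximal UNIV G z \<le> ennreal l" using z by (simp add: U_def)
    let ?Q = "cube x (R / 2)"
    let ?X = "{w \<in> ?Q. local_maximal (cube y (2 * R)) G w > ennreal (A * l)}"
    have X: "?X \<in> sets lebesgue"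
      using level_measurable[of "A * l" "cube y (2 * R)" G] Al cube_measurable[of x "R / 2"]
      by (simp add: Collect_conj_eq sets.Int)
    show "emeasure lebesgue ((W - B) \<inter> ?Q) \<le> ennreal \<delta> * emeasure lebesgue ?Q"
    proof (cases "(W - B) \<inter> ?Q = {}")
      case True then show ?thesis by simp
    next
      case False
      then obtain z1 where "z1 \<in> (W - B) \<inter> ?Q" by blast
      then have z1: "z1 \<in> ?Q" "local_maximal UNIV F z1 \<le> ennreal (\<gamma> * l)"
        by (auto simp: B_def not_less)
      have z0: "z \<in> cube y (2 * \<alpha> * R)"
      proof -
        have "R / (2 * ?d) < 2 * \<alpha> * R / (2 * ?d)"
          using R pos by (intro divide_strict_right_mono) auto
        then show ?thesis using zy unfolding cube_def by (auto intro: le_less_trans)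
      qed
      have "measure lebesgue ?X \<le> (K * (4 * \<alpha>) ^ CARD('d) * \<gamma> / A
        + K * (sqrt ((4 * \<alpha>) ^ CARD('d)) + 1) powr q * A powr (- (q / 2))) * measure lebesgue ?Q"
        by (rule local_level_estimate[OF F G l A0 pos R \<gamma> sub z0 Mz z1 est])
      also have "\<dots> \<le> \<delta> * measure lebesgue ?Q" using small by (intro mult_right_mono) auto
      finally have mX: "measure lebesgue ?X \<le> \<delta> * measure lebesgue ?Q" .
      have Qe: "emeasure lebesgue ?Q = ennreal (measure lebesgue ?Q)"
        using R by (simp add: emeasure_cube measure_cube)
      have "emeasure lebesgue ?X \<le> emeasure lebesgue ?Q" by (intro emeasure_mono) auto
      also have "\<dots> < \<infinity>" by (simp add: Qe)
      finally have "emeasure lebesgue ?X \<noteq> \<infinity>" by simp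
      then have "emeasure lebesgue ?X = ennreal (measure lebesgue ?X)"
        by (simp add: emeasure_eq_ennreal_measure)
      also have "\<dots> \<le> ennreal \<delta> * emeasure lebesgue ?Q"
        unfolding Qe using mX \<delta> by (simp add: ennreal_mult[symmetric] ennreal_leI)
      finally have eX: "emeasure lebesgue ?X \<le> ennreal \<delta> * emeasure lebesgue ?Q" .
      have "(W - B) \<inter> ?Q \<subseteq> ?X"
      proof safe
        fix w assume w: "w \<in> W" "w \<in> ?Q"
        then obtain c r where r: "0 < r" "w \<in> cube c r"
          and gt: "ennreal (A * l) * emeasure lebesgue (cube c r) < (\<integral>\<^sup>+y\<in>cube c r. ennreal \<bar>G y\<bar> \<partial>lebesgue)"
          using Al by (auto simp: W_def local_maximal_gt_iff)
        (* A cube that meets Q and leaves the double of the parent is wider than half the parent,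
           so its dilate by 5 contains the closed parent and with it the point z, where the
           averages of G are at most l.  As A >= 5^d, its own average is then at most A * l. *)
        have "cube c r \<subseteq> cube y (2 * R)"
        proof (rule ccontr)
          assume "\<not> ?thesis"
          then obtain u i where u: "u \<in> cube c r" "\<not> \<bar>u $ i - y $ i\<bar> < 2 * R / (2 * ?d)"
            by (auto simp: cube_def)
          have wy: "\<bar>w $ j - y $ j\<bar> < R / (2 * ?d)" for j
            using subcube_subset[OF R sub] w(2) by (auto simp: cube_def)
          have cw: "\<bar>w $ j - c $ j\<bar> < r / (2 * ?d)" "\<bar>u $ j - c $ j\<bar> < r / (2 * ?d)" for j
            using r u by (auto simp: cube_def)
          have two: "2 * R / (2 * ?d) = 2 * (R / (2 * ?d))" by simp
          have "R / (2 * ?d) < 2 * (r / (2 * ?d))"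
            using u(2) wy[of i] cw[of i] unfolding two by linarith
          have five: "5 * r / (2 * ?d) = 5 * (r / (2 * ?d))" by simp
          have "\<bar>z $ j - c $ j\<bar> < 5 * r / (2 * ?d)" for j
            using \<open>R / (2 * ?d) < 2 * (r / (2 * ?d))\<close> zy[of j] wy[of j] cw(1)[of j] unfolding five by linarith
          then have "z \<in> cube c (5 * r)" by (simp add: cube_def)
          then have "(\<integral>\<^sup>+y\<in>cube c (5 * r). ennreal \<bar>G y\<bar> \<partial>lebesgue)
              \<le> ennreal l * emeasure lebesgue (cube c (5 * r))"
            using l r Mz by (intro average_le) auto
          moreover have "(\<integral>\<^sup>+y\<in>cube c r. ennreal \<bar>G y\<bar> \<partial>lebesgue)
              \<le> (\<integral>\<^sup>+y\<in>cube c (5 * r). ennreal \<bar>G y\<bar> \<partial>lebesgue)"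
            using cube_mono[of r "5 * r" c] r by (intro nn_integral_mono) (auto simp: indicator_def)
          ultimately have "ennreal (A * l) * emeasure lebesgue (cube c r) < ennreal l * emeasure lebesgue (cube c (5 * r))"
            using gt by (meson less_le_trans order_trans)
          moreover have "emeasure lebesgue (cube c (5 * r)) = ennreal (5 ^ CARD('d) * (r / ?d) ^ CARD('d))"
            using r by (simp add: emeasure_cube power_divide power_mult_distrib)
          ultimately have "A * l * (r / ?d) ^ CARD('d) < l * (5 ^ CARD('d) * (r / ?d) ^ CARD('d))"
            using r l Al by (simp add: emeasure_cube ennreal_mult[symmetric] ennreal_less_iff)
          then have "A * (l * (r / ?d) ^ CARD('d)) < 5 ^ CARD('d) * (l * (r / ?d) ^ CARD('d))"
            by (simp only: mult.assoc mult.left_commute)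
          moreover have "0 < l * (r / ?d) ^ CARD('d)" using l r by simp
          ultimately have "A < 5 ^ CARD('d)" by (simp only: mult_less_cancel_right_pos)
          then show False using A by linarith
        qed
        then show "local_maximal (cube y (2 * R)) G w > ennreal (A * l)"
          using r gt Al by (auto simp: local_maximal_gt_iff)
      qed
      then have "emeasure lebesgue ((W - B) \<inter> ?Q) \<le> emeasure lebesgue ?X"
        using X by (rule emeasure_mono)
      then show ?thesis using eX by (rule order_trans)
    qed
  qed
  moreover have "(W - B) \<inter> U = W - B" using WU by blast
  ultimately have "emeasure lebesgue (W - B) \<le> ennreal \<delta> * emeasure lebesgue U" by simp
  moreover have "emeasure lebesgue W \<le> emeasure lebesgue ((W - B) \<union> B)"
    using W B by (intro emeasure_mono) auto
  moreover have "\<dots> \<le> emeasure lebesgue (W - B) + emeasure lebesgue B"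
    using W B by (intro emeasure_subadditive) auto
  ultimately have "emeasure lebesgue W \<le> ennreal \<delta> * emeasure lebesgue U + emeasure lebesgue B"
    by (meson add_right_mono order_trans)
  then show ?thesis unfolding W_def U_def B_def .
qed

section \<open>Summation over a geometric scale of heights\<close>

text \<open>
  The sum is dominated by its largest term, which is below \<open>t powr s\<close>.  The induction carries a
  second bound by the next term of the progression: it makes the step exact, because
  \<open>c = 1 / (1 - A powr (- s))\<close> solves \<open>c * A powr (- s) + 1 = c\<close>.
\<close>

lemma geometric_sum_below:
  fixes A s l t :: real
  assumes A: "1 < A" and s: "0 < s" and l: "0 < l"
  shows "(\<Sum>j<J. if l * A ^ j < t then (l * A ^ j) powr s else 0) \<le> 1 / (1 - A powr (- s)) * t powr s"
proof -
  define c where "c = 1 / (1 - A powr (- s))"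
  have "A powr (- s) < 1" using A s by (simp add: powr_less_one)
  then have c0: "0 < c" and c: "c * A powr (- s) + 1 = c" by (auto simp: c_def field_simps)
  define u where "u j = (l * A ^ j) powr s" for j
  have u0: "0 < u j" for j using A l by (simp add: u_def)
  have uS: "u (Suc j) = A powr s * u j" for j
    using A l by (simp add: u_def powr_mult mult.left_commute)
  have As: "A powr (- s) * A powr s = 1" "1 \<le> A powr s"
    using A s by (auto simp: powr_add[symmetric] ge_one_powr_ge_zero)
  have "(\<Sum>j<J. if l * A ^ j < t then u j else 0) \<le> c * t powr s \<and>
    (\<Sum>j<J. if l * A ^ j < t then u j else 0) \<le> c * A powr (- s) * u J"
  proof (induction J)
    case 0
    then show ?case using c0 u0[of 0] by simp
  next
    case (Suc J)
    let ?S = "\<Sum>j<J. if l * A ^ j < t then u j else 0"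
    have eq: "c * A powr (- s) * u (Suc J) = c * u J" using As(1) by (simp add: uS)
    show ?case
    proof (cases "l * A ^ J < t")
      case True
      have "?S + u J \<le> (c * A powr (- s) + 1) * u J" using Suc by (simp add: algebra_simps)
      then have le: "?S + u J \<le> c * u J" unfolding c .
      have "u J \<le> t powr s" unfolding u_def using True A l s by (intro powr_mono2) auto
      then have "c * u J \<le> c * t powr s" using c0 by simp
      then show ?thesis unfolding eq using le True by simp
    next
      case False
      have "A powr (- s) * (c * u J) \<le> 1 * (c * u J)"
        using \<open>A powr (- s) < 1\<close> c0 u0[of J] by (intro mult_right_mono) auto
      then have "?S \<le> c * u J" using Suc by (simp add: algebra_simps)
      then show ?thesis unfolding eq using Suc False by simp
    qed
  qed
  then show ?thesis unfolding u_def c_def by blast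
qed

text \<open>
  Absorption of half the left-hand side.  Keeping \<open>2 * a J\<close> on the left avoids a subtraction, so
  the argument is valid for infinite values.
\<close>

lemma telescoping_bound:
  fixes a b :: "nat \<Rightarrow> ennreal"
  assumes "\<And>j. 2 * a (Suc j) \<le> a j + 2 * b j"
  shows "(\<Sum>j<J. a j) + 2 * a J \<le> 2 * a 0 + 2 * (\<Sum>j<J. b j)"
proof (induction J)
  case (Suc J)
  have "(\<Sum>j<Suc J. a j) + 2 * a (Suc J) \<le> ((\<Sum>j<J. a j) + 2 * a J) + 2 * b J"
    using add_left_mono[OF assms[of J], of "(\<Sum>j<J. a j) + a J"]
    by (simp only: sum.lessThan_Suc mult_2 add_ac)
  also have "\<dots> \<le> (2 * a 0 + 2 * (\<Sum>j<J. b j)) + 2 * b J" using Suc by (rule add_right_mono)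
  finally show ?case by (simp add: distrib_left ac_simps)
qed simp

lemma powr_le_level_sum:
  fixes A s l g :: real
  assumes A: "1 < A" and s: "0 < s" and l: "0 < l" and g: "l < g" "g \<le> l * A ^ J"
  shows "g powr s \<le> (\<Sum>j<J. (l * A ^ Suc j) powr s * indicator {x. l * A ^ j < x} g)"
  using g(2)
proof (induction J)
  case 0
  then show ?case using g(1) by simp
next
  case (Suc J)
  have nn: "0 \<le> (\<Sum>j<J. (l * A ^ Suc j) powr s * indicator {x. l * A ^ j < x} g)"
    by (intro sum_nonneg) simp
  show ?case
  proof (cases "g \<le> l * A ^ J")
    case True
    then show ?thesis using Suc.IH by simp
  next
    case False
    have "g powr s \<le> (l * A ^ Suc J) powr s" using Suc.prems g l s by (intro powr_mono2) auto
    then show ?thesis using False nn by simp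
  qed
qed

text \<open>
  The estimate is first proved for the part of \<open>G\<close> with values in the range \<open>(l, l A\<^sup>J]\<close>
  (\<open>trunc\<close>), with an error from the lowest height.  Taking \<open>l = A\<^sup>-\<^sup>i\<close>, \<open>J = 2 i\<close> exhausts
  all positive values and sends the error to \<open>0\<close>.
\<close>

lemma power_integral_le_of_good_lambda:
  fixes F G :: "real ^ 'd \<Rightarrow> real"
  assumes F: "integrable lebesgue F" "\<And>x. 0 \<le> F x" and G: "integrable lebesgue G" "\<And>x. 0 \<le> G x"
    and s: "1 < s" and A: "1 < A" and \<gamma>: "0 < \<gamma>"
    and gl: "\<And>l. 0 < l \<Longrightarrow> emeasure lebesgue {x. ennreal (A * l) < local_maximal UNIV G x}
      \<le> ennreal (A powr (- s) / 2) * emeasure lebesgue {x. ennreal l < local_maximal UNIV G x}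
        + emeasure lebesgue {x. ennreal (\<gamma> * l) < local_maximal UNIV F x}"
  shows "(\<integral>\<^sup>+x. ennreal (G x powr s) \<partial>lebesgue)
    \<le> ennreal (2 * A powr s * (2 * weak_const TYPE('d) * A powr s / \<gamma> *
          (1 / (1 - A powr (- (s - 1))) * (2 / \<gamma>) powr (s - 1))))
      * (\<integral>\<^sup>+x. ennreal (F x powr s) \<partial>lebesgue)"
proof -
  have Fm [measurable]: "F \<in> borel_measurable lebesgue" and Gm [measurable]: "G \<in> borel_measurable lebesgue"
    using F G by auto
  have Ffin: "(\<integral>\<^sup>+x. ennreal \<bar>F x\<bar> \<partial>lebesgue) < \<infinity>" and Gfin: "(\<integral>\<^sup>+x. ennreal \<bar>G x\<bar> \<partial>lebesgue) < \<infinity>"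
    using F G by (auto simp: integrable_iff_bounded)
  define W where "W = weak_const TYPE('d)"
  have W: "0 < W" using weak_const_pos W_def by metis
  define k where "k = 2 * W * A powr s / \<gamma>"
  define c where "c = 1 / (1 - A powr (- (s - 1))) * (2 / \<gamma>) powr (s - 1)"
  define I where "I = (\<integral>\<^sup>+x. ennreal (F x powr s) \<partial>lebesgue)"
  define g where "g = enn2real (\<integral>\<^sup>+x. ennreal \<bar>G x\<bar> \<partial>lebesgue)"
  have g: "(\<integral>\<^sup>+x. ennreal \<bar>G x\<bar> \<partial>lebesgue) = ennreal g" "0 \<le> g" using Gfin by (auto simp: g_def)
  have k0: "0 < k" using W A \<gamma> by (simp add: k_def)
  have "A powr (- (s - 1)) < 1" using A s by (simp add: powr_less_one)
  then have c0: "0 < c" using \<gamma> by (simp add: c_def)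
  have trunc: "(\<integral>\<^sup>+x. ennreal (G x powr s) * indicator {x. l < G x \<and> G x \<le> l * A ^ J} x \<partial>lebesgue)
      \<le> ennreal (2 * A powr s * (l powr (s - 1) * (W * g))) + ennreal (2 * A powr s * (k * c)) * I"
    if l: "0 < l" for l J
  proof -
    define L where "L j = l * A ^ j" for j
    have L: "0 < L j" "L (Suc j) = A * L j" for j using l A by (simp_all add: L_def)
    define EG where "EG j = emeasure lebesgue {x. ennreal (L j) < local_maximal UNIV G x}" for j
    define EF where "EF j = emeasure lebesgue {x. ennreal (\<gamma> * L j) < local_maximal UNIV F x}" for j
    (* Up to constants, the sums of a and b are discrete versions of the integrals of (M G)^s and
       (M F)^s.  The factor A^(-s) / 2 in gl is what gives a (Suc j) <= a j / 2 + b j. *)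
    define a where "a j = ennreal (L j powr s) * EG j" for j
    define b where "b j = ennreal (L (Suc j) powr s) * EF j" for j
    have rec: "2 * a (Suc j) \<le> a j + 2 * b j" for j
    proof -
      have "a (Suc j) \<le> ennreal (L (Suc j) powr s) * (ennreal (A powr (- s) / 2) * EG j + EF j)"
        unfolding a_def EG_def EF_def L(2) using gl[OF L(1), of j] by (intro mult_left_mono) auto
      also have "\<dots> = ennreal (L (Suc j) powr s * (A powr (- s) / 2)) * EG j + b j"
        using A by (simp add: distrib_left b_def mult.assoc[symmetric] ennreal_mult[symmetric])
      also have "L (Suc j) powr s * (A powr (- s) / 2) = L j powr s / 2"
        using A L(1)[of j] by (simp add: L(2) powr_mult powr_minus field_simps)
      finally have "2 * a (Suc j) \<le> 2 * (ennreal (L j powr s / 2) * EG j + b j)" by (rule mult_left_mono) simp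
      also have "\<dots> = ennreal 2 * ennreal (L j powr s / 2) * EG j + 2 * b j"
        by (simp add: distrib_left mult.assoc)
      also have "ennreal 2 * ennreal (L j powr s / 2) = ennreal (L j powr s)"
        by (subst ennreal_mult[symmetric]) auto
      finally show ?thesis by (simp add: a_def)
    qed
    have b_le: "b j \<le> (\<integral>\<^sup>+x. ennreal (k * (if L j < 2 * F x / \<gamma> then L j powr (s - 1) else 0) * F x) \<partial>lebesgue)" for j
    proof -
      have "b j = ennreal (L (Suc j) powr s / (\<gamma> * L j)) * (ennreal (\<gamma> * L j) * EF j)"
        using L(1)[of j] \<gamma> by (simp add: b_def mult.assoc[symmetric] ennreal_mult[symmetric])
      also have "\<dots> \<le> ennreal (L (Suc j) powr s / (\<gamma> * L j)) *
          (ennreal (2 * W) * (\<integral>\<^sup>+x\<in>{x. \<gamma> * L j / 2 < \<bar>F x\<bar>}. ennreal \<bar>F x\<bar> \<partial>lebesgue))"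
        unfolding EF_def W_def using L(1)[of j] \<gamma> Ffin by (intro mult_left_mono maximal_truncated_weak_type) auto
      also have "\<dots> = ennreal (k * L j powr (s - 1)) * (\<integral>\<^sup>+x\<in>{x. \<gamma> * L j / 2 < \<bar>F x\<bar>}. ennreal \<bar>F x\<bar> \<partial>lebesgue)"
      proof -
        have "L (Suc j) powr s / (\<gamma> * L j) * (2 * W) = k * L j powr (s - 1)"
          using L(1)[of j] A \<gamma> by (simp add: L(2) k_def powr_mult powr_diff field_simps)
        then show ?thesis using W L(1)[of j] \<gamma> by (simp add: mult.assoc[symmetric] ennreal_mult[symmetric])
      qed
      also have "\<dots> = (\<integral>\<^sup>+x. ennreal (k * L j powr (s - 1)) * (ennreal \<bar>F x\<bar> * indicator {x. \<gamma> * L j / 2 < \<bar>F x\<bar>} x) \<partial>lebesgue)"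
        by (rule nn_integral_cmult[symmetric]) measurable
      also have "\<dots> = (\<integral>\<^sup>+x. ennreal (k * (if L j < 2 * F x / \<gamma> then L j powr (s - 1) else 0) * F x) \<partial>lebesgue)"
      proof (rule nn_integral_cong)
        fix x
        have "\<gamma> * L j / 2 < \<bar>F x\<bar> \<longleftrightarrow> L j < 2 * F x / \<gamma>" using F(2)[of x] \<gamma> by (auto simp: field_simps)
        then show "ennreal (k * L j powr (s - 1)) * (ennreal \<bar>F x\<bar> * indicator {x. \<gamma> * L j / 2 < \<bar>F x\<bar>} x)
          = ennreal (k * (if L j < 2 * F x / \<gamma> then L j powr (s - 1) else 0) * F x)"
          using F(2)[of x] k0 by (auto simp: indicator_def ennreal_mult[symmetric])
      qed
      finally show ?thesis .
    qed
    have "(\<Sum>j<J. b j) \<le> (\<Sum>j<J. \<integral>\<^sup>+x. ennreal (k * (if L j < 2 * F x / \<gamma> then L j powr (s - 1) else 0) * F x) \<partial>lebesgue)"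
      by (intro sum_mono b_le)
    also have "\<dots> = (\<integral>\<^sup>+x. (\<Sum>j<J. ennreal (k * (if L j < 2 * F x / \<gamma> then L j powr (s - 1) else 0) * F x)) \<partial>lebesgue)"
      by (rule nn_integral_sum[symmetric]) measurable
    also have "\<dots> \<le> (\<integral>\<^sup>+x. ennreal (k * c) * ennreal (F x powr s) \<partial>lebesgue)"
    proof (rule nn_integral_mono)
      fix x
      have "(\<Sum>j<J. (if L j < 2 * F x / \<gamma> then L j powr (s - 1) else 0)) \<le> 1 / (1 - A powr (- (s - 1))) * (2 * F x / \<gamma>) powr (s - 1)"
        using geometric_sum_below[OF A, of "s - 1" l "2 * F x / \<gamma>" J] s l by (simp only: L_def diff_gt_0_iff_gt)
      also have "(2 * F x / \<gamma>) powr (s - 1) = (2 / \<gamma>) powr (s - 1) * F x powr (s - 1)"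
        using F(2)[of x] \<gamma> by (subst powr_mult[symmetric]) auto
      finally have *: "(\<Sum>j<J. (if L j < 2 * F x / \<gamma> then L j powr (s - 1) else 0)) \<le> c * F x powr (s - 1)"
        by (simp add: c_def mult.assoc)
      have Fs: "F x powr (s - 1) * F x = F x powr s"
        using F(2)[of x] s by (cases "F x = 0") (auto simp: powr_diff)
      have "(\<Sum>j<J. ennreal (k * (if L j < 2 * F x / \<gamma> then L j powr (s - 1) else 0) * F x))
        = ennreal (\<Sum>j<J. k * (if L j < 2 * F x / \<gamma> then L j powr (s - 1) else 0) * F x)"
        using k0 F(2)[of x] by (intro sum_ennreal) auto
      also have "(\<Sum>j<J. k * (if L j < 2 * F x / \<gamma> then L j powr (s - 1) else 0) * F x)
        = k * (\<Sum>j<J. (if L j < 2 * F x / \<gamma> then L j powr (s - 1) else 0)) * F x"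
        by (simp add: sum_distrib_left sum_distrib_right)
      also have "ennreal \<dots> \<le> ennreal (k * (c * F x powr (s - 1)) * F x)"
        using k0 F(2)[of x] * by (intro ennreal_leI mult_right_mono mult_left_mono) auto
      also have "k * (c * F x powr (s - 1)) * F x = k * c * F x powr s"
        by (simp only: mult.assoc Fs)
      also have "ennreal \<dots> = ennreal (k * c) * ennreal (F x powr s)"
        using k0 c0 by (intro ennreal_mult) auto
      finally show "(\<Sum>j<J. ennreal (k * (if L j < 2 * F x / \<gamma> then L j powr (s - 1) else 0) * F x))
        \<le> ennreal (k * c) * ennreal (F x powr s)" .
    qed
    also have "\<dots> = ennreal (k * c) * I" unfolding I_def by (rule nn_integral_cmult) measurable
    finally have sb: "(\<Sum>j<J. b j) \<le> ennreal (k * c) * I" .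
    have a0: "a 0 \<le> ennreal (l powr (s - 1) * (W * g))"
    proof -
      have "a 0 = ennreal (l powr (s - 1)) * (ennreal l * EG 0)"
        using l by (simp add: a_def L_def mult.assoc[symmetric] ennreal_mult[symmetric] powr_diff)
      also have "\<dots> \<le> ennreal (l powr (s - 1)) * (ennreal W * ennreal g)"
        using maximal_weak_type[OF Gm l Gfin] unfolding g by (intro mult_left_mono) (auto simp: EG_def L_def W_def)
      also have "\<dots> = ennreal (l powr (s - 1) * (W * g))"
        using W g(2) by (simp add: ennreal_mult)
      finally show ?thesis .
    qed
    have "(\<integral>\<^sup>+x. ennreal (G x powr s) * indicator {x. l < G x \<and> G x \<le> l * A ^ J} x \<partial>lebesgue)
      \<le> (\<integral>\<^sup>+x. (\<Sum>j<J. ennreal (L (Suc j) powr s) * indicator {x. L j < \<bar>G x\<bar>} x) \<partial>lebesgue)"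
    proof (rule nn_integral_mono)
      fix x
      show "ennreal (G x powr s) * indicator {x. l < G x \<and> G x \<le> l * A ^ J} x
        \<le> (\<Sum>j<J. ennreal (L (Suc j) powr s) * indicator {x. L j < \<bar>G x\<bar>} x)"
      proof (cases "l < G x \<and> G x \<le> l * A ^ J")
        case True
        have "ennreal (G x powr s) \<le> ennreal (\<Sum>j<J. L (Suc j) powr s * indicator {x. L j < x} (G x))"
          using powr_le_level_sum[OF A _ l, of s "G x" J] True s unfolding L_def by (intro ennreal_leI) auto
        also have "\<dots> = (\<Sum>j<J. ennreal (L (Suc j) powr s * indicator {x. L j < x} (G x)))"
          by (rule sum_ennreal[symmetric]) simp
        also have "\<dots> = (\<Sum>j<J. ennreal (L (Suc j) powr s) * indicator {x. L j < \<bar>G x\<bar>} x)"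
          using G(2)[of x] by (intro sum.cong) (auto simp: indicator_def)
        finally show ?thesis using True by simp
      qed simp
    qed
    also have "\<dots> = (\<Sum>j<J. \<integral>\<^sup>+x. ennreal (L (Suc j) powr s) * indicator {x. L j < \<bar>G x\<bar>} x \<partial>lebesgue)"
      by (rule nn_integral_sum) measurable
    also have "\<dots> \<le> (\<Sum>j<J. ennreal (A powr s) * a j)"
    proof (rule sum_mono)
      fix j
      have "{x \<in> space lebesgue. L j < \<bar>G x\<bar>} \<in> sets lebesgue" by measurable
      then have "(\<integral>\<^sup>+x. ennreal (L (Suc j) powr s) * indicator {x. L j < \<bar>G x\<bar>} x \<partial>lebesgue)
        = ennreal (L (Suc j) powr s) * emeasure lebesgue {x. L j < \<bar>G x\<bar>}"
        by (intro nn_integral_cmult_indicator) simp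
      also have "\<dots> \<le> ennreal (L (Suc j) powr s) * EG j"
        unfolding EG_def using L(1) Gfin by (intro mult_left_mono emeasure_level_le_maximal) auto
      also have "\<dots> = ennreal (A powr s) * a j"
        using A L(1)[of j] by (simp add: a_def L(2) powr_mult ennreal_mult mult.assoc)
      finally show "(\<integral>\<^sup>+x. ennreal (L (Suc j) powr s) * indicator {x. L j < \<bar>G x\<bar>} x \<partial>lebesgue)
        \<le> ennreal (A powr s) * a j" .
    qed
    also have "\<dots> = ennreal (A powr s) * (\<Sum>j<J. a j)" by (rule sum_distrib_left[symmetric])
    also have "\<dots> \<le> ennreal (A powr s) * (2 * a 0 + 2 * (\<Sum>j<J. b j))"
      using telescoping_bound[of a b J, OF rec] by (intro mult_left_mono) (auto intro: order_trans[rotated])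
    also have "\<dots> \<le> ennreal (A powr s) * (2 * ennreal (l powr (s - 1) * (W * g)) + 2 * (ennreal (k * c) * I))"
      using a0 sb by (intro mult_left_mono add_mono) auto
    also have "\<dots> = ennreal (2 * A powr s * (l powr (s - 1) * (W * g))) + ennreal (2 * A powr s * (k * c)) * I"
    proof -
      have "ennreal (A powr s) * (2 * ennreal y) = ennreal (2 * A powr s * y)" if "0 \<le> y" for y
      proof -
        have "ennreal (A powr s) * (2 * ennreal y) = ennreal 2 * ennreal (A powr s) * ennreal y"
          by (simp add: ac_simps)
        also have "\<dots> = ennreal (2 * A powr s * y)" using that by (simp add: ennreal_mult)
        finally show ?thesis .
      qed
      note * = this
      show ?thesis
        using *[of "l powr (s - 1) * (W * g)"] *[of "k * c"] W g(2) k0 c0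
        by (simp add: distrib_left mult.assoc[symmetric])
    qed
    finally show ?thesis .
  qed
  define \<phi> where "\<phi> i x = ennreal (G x powr s) * indicator {x. inverse (A ^ i) < G x \<and> G x \<le> A ^ i} x" for i x
  define \<epsilon> where "\<epsilon> i = 2 * A powr s * ((A powr (- (s - 1))) ^ i * (W * g))" for i
  have bound: "(\<integral>\<^sup>+x. \<phi> i x \<partial>lebesgue) \<le> ennreal (\<epsilon> i) + ennreal (2 * A powr s * (k * c)) * I" for i
  proof -
    have "inverse (A ^ i) * A ^ (2 * i) = A ^ i" using A by (simp add: mult_2 power_add)
    moreover have "inverse (A ^ i) powr (s - 1) = (A powr (- (s - 1))) ^ i"
      using A by (simp add: powr_powr powr_realpow[symmetric] powr_minus[symmetric] algebra_simps)
    ultimately show ?thesis using trunc[of "inverse (A ^ i)" "2 * i"] A by (simp add: \<phi>_def \<epsilon>_def)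
  qed
  have "(\<lambda>i. \<integral>\<^sup>+x. \<phi> i x \<partial>lebesgue) \<longlonglongrightarrow> (\<integral>\<^sup>+x. ennreal (G x powr s) \<partial>lebesgue)"
  proof (rule nn_integral_LIMSEQ)
    show "incseq \<phi>"
    proof (rule incseq_SucI, rule le_funI)
      fix i x
      have "A ^ i \<le> A ^ Suc i" using A by (intro power_increasing) auto
      moreover have "inverse (A ^ Suc i) \<le> inverse (A ^ i)"
        using A \<open>A ^ i \<le> A ^ Suc i\<close> by (intro le_imp_inverse_le) auto
      ultimately show "\<phi> i x \<le> \<phi> (Suc i) x" unfolding \<phi>_def indicator_def by auto
    qed
    show "\<phi> i \<in> borel_measurable lebesgue" for i unfolding \<phi>_def by measurable
    fix x
    show "(\<lambda>i. \<phi> i x) \<longlonglongrightarrow> ennreal (G x powr s)"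
    proof (cases "G x = 0")
      case True
      then show ?thesis by (simp add: \<phi>_def)
    next
      case False
      then have gx: "0 < G x" using G(2)[of x] by simp
      obtain n where n: "max (G x) (inverse (G x)) < A ^ n" using real_arch_pow[OF A] by blast
      have "\<phi> i x = ennreal (G x powr s)" if "n \<le> i" for i
      proof -
        have "A ^ n \<le> A ^ i" using A that by (intro power_increasing) auto
        then have "G x \<le> A ^ i" "inverse (G x) < A ^ i" using n by auto
        moreover from this(2) have "inverse (A ^ i) < G x"
          using gx A by (simp add: field_simps)
        ultimately show ?thesis by (simp add: \<phi>_def)
      qed
      then show ?thesis by (intro tendsto_eventually eventually_sequentiallyI[of n])
    qed
  qed
  moreover have "(\<lambda>i. ennreal (\<epsilon> i) + ennreal (2 * A powr s * (k * c)) * I) \<longlonglongrightarrow>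
      ennreal 0 + ennreal (2 * A powr s * (k * c)) * I"
  proof (intro tendsto_add tendsto_ennrealI tendsto_const)
    have "(\<lambda>i. (A powr (- (s - 1))) ^ i) \<longlonglongrightarrow> 0"
      using \<open>A powr (- (s - 1)) < 1\<close> by (intro LIMSEQ_power_zero) simp
    from tendsto_mult_right_zero[OF this, of "2 * A powr s * (W * g)"]
    show "\<epsilon> \<longlonglongrightarrow> 0" unfolding \<epsilon>_def by (simp only: mult_ac)
  qed
  ultimately have "(\<integral>\<^sup>+x. ennreal (G x powr s) \<partial>lebesgue) \<le> ennreal 0 + ennreal (2 * A powr s * (k * c)) * I"
    by (rule LIMSEQ_le) (use bound in auto)
  then show ?thesis unfolding k_def c_def W_def I_def by simp
qed

section \<open>Extrapolation\<close>

text \<open>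
  The constants are chosen in the order \<open>A\<close>, \<open>\<gamma>\<close>: since \<open>q/2 > s\<close>, a large \<open>A\<close> brings the second
  term of the good-\<open>\<lambda>\<close> constant below \<open>A\<^sup>-\<^sup>s/4\<close>; for this \<open>A\<close> a small \<open>\<gamma>\<close> does the same for
  the first.
\<close>

lemma Shen_extrapolation_scalar:
  fixes s q \<alpha> K :: real
  assumes s: "1 < s" and q: "2 * s < q" and \<alpha>: "1 < \<alpha>" and K: "0 < K"
  shows "\<exists>C>0. \<forall>F G :: real ^ 'd \<Rightarrow> real.
    integrable lebesgue F \<longrightarrow> (\<forall>x. 0 \<le> F x) \<longrightarrow> integrable lebesgue G \<longrightarrow> (\<forall>x. 0 \<le> G x) \<longrightarrow>
    scalar_weak_type K q \<alpha> F G \<longrightarrow>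
    (\<integral>\<^sup>+x. ennreal (G x powr s) \<partial>lebesgue) \<le> ennreal C * (\<integral>\<^sup>+x. ennreal (F x powr s) \<partial>lebesgue)"
proof -
  define c where "c = (4 * \<alpha>) ^ CARD('d)"
  have c: "0 < c" using \<alpha> by (simp add: c_def)
  define m where "m = 4 * K * (sqrt c + 1) powr q"
  have "0 < sqrt c + 1" using c by (simp add: add_pos_pos)
  then have m: "0 < m" using K by (simp add: m_def)
  define t where "t = q / 2 - s"
  have t: "0 < t" using q by (simp add: t_def)
  define A where "A = max (5 ^ CARD('d)) (m powr (1 / t))"
  have "(1 :: real) < 5 ^ CARD('d)" by (simp add: one_less_power)
  then have A5: "5 ^ CARD('d) \<le> A" and A1: "1 < A" unfolding A_def by linarith+
  have "m = (m powr (1 / t)) powr t" using m t by (simp add: powr_powr)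
  also have "\<dots> \<le> A powr t" using t by (intro powr_mono2) (auto simp: A_def)
  finally have mA: "m \<le> A powr t" .
  have "m * A powr (- (q / 2)) \<le> A powr t * A powr (- (q / 2))" using mA by (rule mult_right_mono) simp
  also have "\<dots> = A powr (- s)" by (simp add: powr_add[symmetric] t_def)
  finally have s2: "K * (sqrt c + 1) powr q * A powr (- (q / 2)) \<le> A powr (- s) / 4" by (simp add: m_def)
  define \<gamma> where "\<gamma> = min 1 (A powr (1 - s) / (4 * K * c))"
  have \<gamma>: "0 < \<gamma>" "\<gamma> \<le> 1" using K c A1 by (auto simp: \<gamma>_def)
  have "K * c * \<gamma> / A \<le> K * c * (A powr (1 - s) / (4 * K * c)) / A"
    using K c A1 by (intro divide_right_mono mult_left_mono) (auto simp: \<gamma>_def)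
  also have "\<dots> = A powr (- s) / 4" using K c A1 by (simp add: powr_diff powr_minus field_simps)
  finally have s1: "K * c * \<gamma> / A \<le> A powr (- s) / 4" .
  have small: "K * (4 * \<alpha>) ^ CARD('d) * \<gamma> / A
      + K * (sqrt ((4 * \<alpha>) ^ CARD('d)) + 1) powr q * A powr (- (q / 2)) \<le> A powr (- s) / 2"
    using s1 s2 unfolding c_def by linarith
  define C where "C = 2 * A powr s * (2 * weak_const TYPE('d) * A powr s / \<gamma> *
    (1 / (1 - A powr (- (s - 1))) * (2 / \<gamma>) powr (s - 1)))"
  have "A powr (- (s - 1)) < 1" using A1 s by (simp add: powr_less_one)
  then have "0 < C" using A1 \<gamma> weak_const_pos[where 'd='d] by (simp add: C_def)
  moreover have q0: "0 < q" using s q by linarith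
  ultimately show ?thesis
  proof (intro exI[of _ C] conjI allI impI, goal_cases)
    case (2 F G)
    show ?case unfolding C_def
    proof (rule power_integral_le_of_good_lambda)
      fix l :: real assume l: "0 < l"
      show "emeasure lebesgue {x. ennreal (A * l) < local_maximal UNIV G x}
        \<le> ennreal (A powr (- s) / 2) * emeasure lebesgue {x. ennreal l < local_maximal UNIV G x}
          + emeasure lebesgue {x. ennreal (\<gamma> * l) < local_maximal UNIV F x}"
        by (rule good_lambda[where K = K and q = q and \<alpha> = \<alpha>, OF _ _ _ _ K q0 \<alpha> \<gamma> A5 small _ l])
          (use 2 in blast)+
    qed (use 2 s A1 \<gamma> in auto)
  qed
qed

lemma cnorm_nonneg: "0 \<le> cnorm k v"
  by (simp add: cnorm_def)

lemma cnorm_ext_zero: "cnorm k (ext_zero \<Omega> u x) = indicator \<Omega> x * cnorm k (u x)"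
  by (simp add: ext_zero_def cnorm_def L2_set_def)

lemma cnorm_power2_powr: "((cnorm k v)\<^sup>2) powr (p / 2) = cnorm k v powr p"
  using cnorm_nonneg[of k v] by (cases "cnorm k v = 0") (auto simp: powr_powr powr_numeral[symmetric] simp del: powr_numeral)

lemma set_integral_Int_ext_zero:
  "(LINT x:A \<inter> \<Omega>|lebesgue. (cnorm k (u x))\<^sup>2) = (LINT x:A|lebesgue. (cnorm k (ext_zero \<Omega> u x))\<^sup>2)"
  unfolding set_lebesgue_integral_def
  by (intro Bochner_Integration.integral_cong) (auto simp: cnorm_ext_zero indicator_def)

lemma integrable_ext_zero:
  assumes "\<Omega> \<in> sets lebesgue" "u \<in> Lp_space k 2 \<Omega>"
  shows "integrable lebesgue (\<lambda>x. (cnorm k (ext_zero \<Omega> u x))\<^sup>2)"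
proof -
  have "integrable lebesgue (\<lambda>x. indicator \<Omega> x *\<^sub>R (cnorm k (u x) powr 2))"
    using assms by (subst integrable_restrict_space[symmetric]) (auto simp: Lp_space_def)
  moreover have "indicator \<Omega> x *\<^sub>R (cnorm k (u x) powr 2) = (cnorm k (ext_zero \<Omega> u x))\<^sup>2" for x
    using cnorm_nonneg[of k "u x"] by (simp add: cnorm_ext_zero indicator_def)
  ultimately show ?thesis by simp
qed

lemma nn_integral_ext_zero:
  assumes "\<Omega> \<in> sets lebesgue" "0 < p"
  shows "(\<integral>\<^sup>+x. ennreal (((cnorm k (ext_zero \<Omega> u x))\<^sup>2) powr (p / 2)) \<partial>lebesgue)
    = (\<integral>\<^sup>+x. ennreal (cnorm k (u x) powr p) \<partial>lebesgue_on \<Omega>)"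
proof -
  have "(\<integral>\<^sup>+x. ennreal (cnorm k (u x) powr p) \<partial>lebesgue_on \<Omega>)
    = (\<integral>\<^sup>+x. ennreal (cnorm k (u x) powr p) * indicator \<Omega> x \<partial>lebesgue)"
    using assms by (intro nn_integral_restrict_space) auto
  also have "\<dots> = (\<integral>\<^sup>+x. ennreal (((cnorm k (ext_zero \<Omega> u x))\<^sup>2) powr (p / 2)) \<partial>lebesgue)"
    unfolding cnorm_power2_powr using assms(2) by (intro nn_integral_cong) (auto simp: cnorm_ext_zero indicator_def)
  finally show ?thesis by simp
qed

lemma local_maximal_eq_0:
  assumes "\<And>y. y \<in> B \<Longrightarrow> g y = 0"
  shows "local_maximal B g x = 0"
proof -
  have "\<not> ennreal 0 < local_maximal B g x"
  proof (subst local_maximal_gt_iff, simp, clarify)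
    fix c r
    assume "cube c r \<subseteq> B"
      and "ennreal 0 * emeasure lebesgue (cube c r) < (\<integral>\<^sup>+y\<in>cube c r. ennreal \<bar>g y\<bar> \<partial>lebesgue)"
    moreover have "(\<integral>\<^sup>+y\<in>cube c r. ennreal \<bar>g y\<bar> \<partial>lebesgue) = (\<integral>\<^sup>+y\<in>cube c r. 0 \<partial>lebesgue)"
      using assms \<open>cube c r \<subseteq> B\<close> by (intro nn_integral_cong) (auto simp: indicator_def)
    ultimately show False by simp
  qed
  then show ?thesis by simp
qed

lemma scalar_weak_type_ext_zero:
  fixes f Tf :: "real ^ 'd \<Rightarrow> nat \<Rightarrow> complex"
  assumes weak: "weak_type_estimate m n q \<alpha> K \<Omega> f Tf" and K: "0 < K"
  shows "scalar_weak_type K q \<alpha> (\<lambda>x. (cnorm m (ext_zero \<Omega> f x))\<^sup>2)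
    (\<lambda>x. (cnorm n (ext_zero \<Omega> Tf x))\<^sup>2)"
    (is "scalar_weak_type K q \<alpha> ?F ?G")
  unfolding scalar_weak_type_def
proof (intro allI impI)
  fix \<iota> R :: real and x y :: "real ^ 'd"
  assume \<iota>: "0 < \<iota>" and R: "0 < R" and sub: "cube x (R / 2) \<in> subcubes y R"
  let ?X = "{w \<in> cube x (R / 2). local_maximal (cube y (2 * R)) ?G w > ennreal \<iota>}"
  let ?S = "(SUP Q' \<in> {Q' \<in> cubes. cube y (2 * R) \<subseteq> Q'}.
              sqrt (1 / measure lebesgue Q' * (LINT x:Q'|lebesgue. ?F x)))"
  show "measure lebesgue ?X \<le> K / \<iota> * (LINT x:cube y (2 * \<alpha> * R)|lebesgue. ?F x)
      + K * measure lebesgue (cube x (R / 2)) / \<iota> powr (q / 2) *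
        (sqrt (1 / measure lebesgue (cube x (R / 2)) * (LINT x:cube y (2 * \<alpha> * R)|lebesgue. ?G x)) + ?S) powr q"
  proof (cases "cube y (2 * R) \<inter> \<Omega> = {}")
    case False
    have "0 < R / 2" using R by simp
    with weak[unfolded weak_type_estimate_def set_integral_Int_ext_zero] \<iota> R sub False
    show ?thesis by blast
  next
    case True
    then have "local_maximal (cube y (2 * R)) ?G w = 0" for w
      by (intro local_maximal_eq_0) (auto simp: cnorm_ext_zero indicator_def)
    then have "?X = {}" by simp
    then have "measure lebesgue ?X = 0" by (simp only: measure_empty)
    moreover have "0 \<le> K / \<iota> * (LINT x:cube y (2 * \<alpha> * R)|lebesgue. ?F x)"
      using K \<iota> unfolding set_lebesgue_integral_def
      by (intro mult_nonneg_nonneg integral_nonneg_AE) (auto simp: indicator_def)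
    moreover have "0 \<le> K * measure lebesgue (cube x (R / 2)) / \<iota> powr (q / 2) *
        (sqrt (1 / measure lebesgue (cube x (R / 2)) * (LINT x:cube y (2 * \<alpha> * R)|lebesgue. ?G x)) + ?S) powr q"
      using K by simp
    ultimately show ?thesis by linarith
  qed
qed

theorem theorem5p3:
  fixes p q \<alpha>\<^sub>1 \<alpha>\<^sub>2 K :: real
  assumes "2 < p" and "p < q" and "1 < \<alpha>\<^sub>1" and "\<alpha>\<^sub>1 < \<alpha>\<^sub>2" and "0 < K"
  shows "\<exists>C > 0. \<forall>m \<ge> 1. \<forall>n \<ge> 1. \<forall>\<Omega> :: (real ^ 'd) set. \<forall>f.
           \<forall>T :: (real ^ 'd \<Rightarrow> nat \<Rightarrow> complex) \<rightharpoonup> (real ^ 'd \<Rightarrow> nat \<Rightarrow> complex). \<forall>Tf.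
             \<Omega> \<in> sets lebesgue \<longrightarrow>
             f \<in> Lp_space m 2 \<Omega> \<inter> Lp_space m p \<Omega> \<longrightarrow>
             T f = Some Tf \<longrightarrow> Tf \<in> Lp_space n 2 \<Omega> \<longrightarrow>
             weak_type_estimate m n q \<alpha>\<^sub>2 K \<Omega> f Tf \<longrightarrow>
             Tf \<in> Lp_space n p \<Omega> \<and> Lp_norm n p \<Omega> Tf \<le> C * Lp_norm m p \<Omega> f"
proof -
  have "1 < p / 2" "2 * (p / 2) < q" "1 < \<alpha>\<^sub>2" using assms by auto
  from Shen_extrapolation_scalar[OF this assms(5), where 'd='d]
  obtain C where C: "0 < C" and ext: "\<And>F G :: real ^ 'd \<Rightarrow> real.
    integrable lebesgue F \<Longrightarrow> (\<And>x. 0 \<le> F x) \<Longrightarrow> integrable lebesgue G \<Longrightarrow> (\<And>x. 0 \<le> G x) \<Longrightarrow>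
    scalar_weak_type K q \<alpha>\<^sub>2 F G \<Longrightarrow>
    (\<integral>\<^sup>+x. ennreal (G x powr (p / 2)) \<partial>lebesgue) \<le> ennreal C * (\<integral>\<^sup>+x. ennreal (F x powr (p / 2)) \<partial>lebesgue)"
    by (elim exE conjE) blast
  show ?thesis
  proof (intro exI[of _ "C powr (1 / p)"] conjI allI impI)
    show "0 < C powr (1 / p)" using C by simp
    fix m n :: nat and \<Omega> :: "(real ^ 'd) set" and f Tf
      and T :: "(real ^ 'd \<Rightarrow> nat \<Rightarrow> complex) \<rightharpoonup> (real ^ 'd \<Rightarrow> nat \<Rightarrow> complex)"
    assume \<Omega>: "\<Omega> \<in> sets lebesgue" and f: "f \<in> Lp_space m 2 \<Omega> \<inter> Lp_space m p \<Omega>"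
      and Tf: "Tf \<in> Lp_space n 2 \<Omega>" and weak: "weak_type_estimate m n q \<alpha>\<^sub>2 K \<Omega> f Tf"
    let ?F = "\<lambda>x. (cnorm m (ext_zero \<Omega> f x))\<^sup>2" and ?G = "\<lambda>x. (cnorm n (ext_zero \<Omega> Tf x))\<^sup>2"
    have main: "(\<integral>\<^sup>+x. ennreal (?G x powr (p / 2)) \<partial>lebesgue) \<le> ennreal C * (\<integral>\<^sup>+x. ennreal (?F x powr (p / 2)) \<partial>lebesgue)"
    proof (rule ext)
      show "integrable lebesgue ?F" "integrable lebesgue ?G"
        using \<Omega> f Tf by (auto intro: integrable_ext_zero)
      show "scalar_weak_type K q \<alpha>\<^sub>2 ?F ?G"
        using weak assms(5) by (intro scalar_weak_type_ext_zero) auto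
    qed auto
    have p: "0 < p" using assms by simp
    have fp: "integrable (lebesgue_on \<Omega>) (\<lambda>x. cnorm m (f x) powr p)" using f by (simp add: Lp_space_def)
    have "(\<integral>\<^sup>+x. ennreal (cnorm n (Tf x) powr p) \<partial>lebesgue_on \<Omega>)
      \<le> ennreal C * (\<integral>\<^sup>+x. ennreal (cnorm m (f x) powr p) \<partial>lebesgue_on \<Omega>)"
      using main unfolding nn_integral_ext_zero[OF \<Omega> p] .
    also have "\<dots> = ennreal (C * (\<integral>x. cnorm m (f x) powr p \<partial>lebesgue_on \<Omega>))"
      using C fp by (simp add: nn_integral_eq_integral ennreal_mult integral_nonneg_AE)
    finally have le: "(\<integral>\<^sup>+x. ennreal (cnorm n (Tf x) powr p) \<partial>lebesgue_on \<Omega>)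
      \<le> ennreal (C * (\<integral>x. cnorm m (f x) powr p \<partial>lebesgue_on \<Omega>))" .
    have comp [measurable]: "(\<lambda>x. Tf x i) \<in> borel_measurable (lebesgue_on \<Omega>)" if "i < n" for i
      using Tf that by (simp add: Lp_space_def)
    have "(\<lambda>x. cnorm n (Tf x) powr p) \<in> borel_measurable (lebesgue_on \<Omega>)"
      unfolding cnorm_def L2_set_def by measurable
    then have Tp: "integrable (lebesgue_on \<Omega>) (\<lambda>x. cnorm n (Tf x) powr p)"
      using le by (intro integrableI_bounded) (auto intro: le_less_trans)
    then show "Tf \<in> Lp_space n p \<Omega>" using comp by (simp add: Lp_space_def)
    have I: "0 \<le> (\<integral>x. cnorm m (f x) powr p \<partial>lebesgue_on \<Omega>)" "0 \<le> (\<integral>x. cnorm n (Tf x) powr p \<partial>lebesgue_on \<Omega>)"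
      by (simp_all add: integral_nonneg_AE)
    have "(\<integral>x. cnorm n (Tf x) powr p \<partial>lebesgue_on \<Omega>) \<le> C * (\<integral>x. cnorm m (f x) powr p \<partial>lebesgue_on \<Omega>)"
      using le Tp C I by (simp add: nn_integral_eq_integral ennreal_le_iff)
    then have "Lp_norm n p \<Omega> Tf \<le> (C * (\<integral>x. cnorm m (f x) powr p \<partial>lebesgue_on \<Omega>)) powr (1 / p)"
      unfolding Lp_norm_def using I p by (intro powr_mono2) auto
    also have "\<dots> = C powr (1 / p) * Lp_norm m p \<Omega> f"
      unfolding Lp_norm_def using C I by (simp add: powr_mult)
    finally show "Lp_norm n p \<Omega> Tf \<le> C powr (1 / p) * Lp_norm m p \<Omega> f" .
  qed
qed

end
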